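(* Let $\sigma$ and $\tau$ be types of a positive integer $n$. The coefficient of $e^\otimes_\tau$ in the $e^\otimes$-expansion of $E^+_\sigma$ is $\sum_T\mathrm{psgn}_+(T)$, where the sum is over all bounded polywrapping block tabloids $T$ of shape $\sigma$ and content $\tau$.
   Context: **Types.** A composition is a finite (possibly empty) list $\beta$ of positive integers, with $\mathrm{area}(\beta)$ the sum of its entries and $\ell(\beta)$ its length. A partition is a weakly decreasing composition; $\mathrm{sort}(\beta)$ is the partition obtained by sorting $\beta$. An ordered type of $n$ is a sequence $\delta=(\delta|_1,\delta|_2,\ldots)$ of compositions with $\sum_i i\,\mathrm{area}(\delta|_i)=n$, written $\delta=1^{\delta|_1}2^{\delta|_2}\cdots$; $\mathrm{area}(\delta)=\sum_i\mathrm{area}(\delta|_i)$. A type is an ordered type with all $\delta|_i$ partitions, and $\mathrm{psort}(\delta)$ is the type obtained by replacing each $\delta|_i$ by $\mathrm{sort}(\delta|_i)$. A block $d^r$ ($d,r\ge1$) is the ordered type with $\delta|_d=(r)$ and all other $\delta|_i$ empty. A type $\tau$ is identified with the multiset of its blocks (one copy of $d^r$ for each part $r$ of $\tau|_d$), and we list its blocks as $d_1^{r_1}\cdots d_k^{r_k}$. An $r$-ordered type is an ordered type $\delta$ with $\mathrm{area}(\delta|_i)$ divisible by $r$ for all $i$; $\mathrm{OTyp}_r(n)$ is the set of $r$-ordered types of $n$. **Polysymmetric functions.** Let $x_{ij}$ ($i,j\ge1$) be commuting indeterminates with $\deg x_{ij}=i$. $\mathrm{PSym}$ is the $\mathbb{Q}$-algebra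 of bounded-degree formal power series in the $x_{ij}$ invariant under swapping $x_{ij}$ and $x_{ik}$ for all $i,j,k$; $\mathrm{PSym}(n)$ is its degree $n$ part. For an ordered type $\delta$, $e^\otimes_\delta=\prod_i e_{\delta|_i}(x_{i1},x_{i2},\ldots)$ where $e_\beta=\prod_j e_{\beta_j}$; $\{e^\otimes_\tau\}$ over types $\tau$ of $n$ is a basis of $\mathrm{PSym}(n)$, and the $e^\otimes$-expansion is the expansion in this basis. $E^+_d$ is the sum of all square-free monomials of degree $d$ in the $x_{ij}$; $E^+_{d^r}$ is obtained from $E^+_d$ by replacing each $x_{ij}$ by $x_{ij}^r$; $E^+_\sigma=\prod_{i=1}^kE^+_{d_i^{r_i}}$ for $\sigma=d_1^{r_1}\cdots d_k^{r_k}$. **The function $\hat{s}_r$.** For an $r$-tuple $w=(w_0,\ldots,w_{r-1})$ of non-negative integers, let $v_i$ be the remainder of $w_i+i$ upon division by $r$; $\hat{s}_r(w)=(-1)^{\#\{i<j:\,v_i>v_j\}}$ if the $v_i$ are distinct, and $0$ otherwise. For a composition $\beta$ with $\ell(\beta)\le r$, $\hat{s}_r(\beta)=\sum_w\hat{s}_r(w)$ over all $r$-tuples $w$ of non-negative integers that become $\beta$ on deleting zeros; if $\ell(\beta)>r$, $\hat{s}_r(\beta)=0$. For an ordered type $\delta$, $\hat{s}_r(\delta)=\prod_i\hat{s}_r(\delta|_i)$. **Wrappings and polywrappings.** View the block $d^r$ as an array of boxes with $d$ rows and $r$ columns. For $k\mid d$, divide the rows from top to bottom into $d/k$ "$k$-sheets"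 of $k$ consecutive rows; list the $dr/k$ columns of $k$-sheets in reading order (first sheet left to right, then second sheet left to right, etc.). For a composition $\beta=(\beta_1,\ldots,\beta_l)$ of $dr/k$, the $k$-wrapping of $d^r$ of content $\beta$ is the set partition $(B_1,\ldots,B_l)$ of the boxes where $B_1$ is the first $\beta_1$ sheet-columns, $B_2$ the next $\beta_2$, etc.; the $B_j$ are called rectangles of height $k$. Given $\rho\in\mathrm{OTyp}_r(dr)$, the polywrapping $D$ of $d^r$ of ordered content $\mathrm{pocon}(D)=\rho$ is obtained by dividing the $d$ rows, from top to bottom for $k=1,2,\ldots$, into consecutive groups of $k\,\mathrm{area}(\rho|_k)/r$ rows, and putting on the $k$th group the $k$-wrapping of content $\rho|_k$. $D$ is $r$-bounded if it has at most $r$ rectangles of each height, i.e. $\ell(\rho|_k)\le r$ for all $k$. Set $\mathrm{psgn}_+(D)=(-1)^{(r-1)\mathrm{area}(\rho)/r}\,\hat{s}_r(\rho)$. **Bounded polywrapping block tabloids.** A bounded polywrapping block tabloid $T$ of shape $\sigma=d_1^{r_1}\cdots d_k^{r_k}$ and content $\tau$ is a list $(D^{(1)},\ldots,D^{(k)})$ where $D^{(i)}$ is an $r_i$-bounded polywrapping of $d_i^{r_i}$ and the multiset union of the blocks of $\mathrm{psort}(\mathrm{pocon}(D^{(i)}))$, $1\le i\le k$, equals $\tau$. Set $\mathrm{psgn}_+(T)=\prod_{i=1}^k\mathrm{psgn}_+(D^{(i)})$. *)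

theory Defs
  imports Complex_Main "HOL-Library.Multiset" "HOL-Combinatorics.Transposition"
begin

section \<open>Polysymmetric functions\<close>

text \<open>
  The indeterminate \<open>x\<^sub>i\<^sub>j\<close> is the pair \<open>(i, j)\<close> with \<open>i, j \<ge> 1\<close>, and a monomial is
  the multiset of its indeterminates. A formal power series is identified with its coefficient
  function on multisets of pairs, which has to vanish on multisets containing a pair outside
  \<open>indets\<close>.
\<close>

type_synonym monom = "(nat \<times> nat) multiset"

definition indets :: "(nat \<times> nat) set" where
  "indets = {1..} \<times> {1..}"

definition mdeg :: "monom \<Rightarrow> nat" where
  "mdeg m = (\<Sum>(i, j)\<in>#m. i)"

definition squarefree_monom :: "monom \<Rightarrow> bool" where
  "squarefree_monom m \<longleftrightarrow> (\<forall>v. count m v \<le> 1)"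

definition swap_indets :: "nat \<Rightarrow> nat \<Rightarrow> nat \<Rightarrow> monom \<Rightarrow> monom" where
  "swap_indets i j k m = image_mset (Transposition.transpose (i, j) (i, k)) m"

definition polysymmetric :: "(monom \<Rightarrow> rat) \<Rightarrow> bool" where
  "polysymmetric f \<longleftrightarrow>
     (\<forall>m. f m \<noteq> 0 \<longrightarrow> set_mset m \<subseteq> indets) \<and>
     (\<exists>N. \<forall>m. f m \<noteq> 0 \<longrightarrow> mdeg m \<le> N) \<and>
     (\<forall>i\<ge>1. \<forall>j\<ge>1. \<forall>k\<ge>1. \<forall>m. f (swap_indets i j k m) = f m)"

lemma polysymmetricI:
  assumes "\<And>m. f m \<noteq> 0 \<Longrightarrow> set_mset m \<subseteq> indets"
    and "\<And>m. f m \<noteq> 0 \<Longrightarrow> mdeg m \<le> N"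
    and "\<And>i j k m. i \<ge> 1 \<Longrightarrow> j \<ge> 1 \<Longrightarrow> k \<ge> 1 \<Longrightarrow> f (swap_indets i j k m) = f m"
  shows "polysymmetric f"
  using assms unfolding polysymmetric_def by blast

lemma polysymmetricE:
  assumes "polysymmetric f"
  obtains N where "\<And>m. f m \<noteq> 0 \<Longrightarrow> set_mset m \<subseteq> indets"
    and "\<And>m. f m \<noteq> 0 \<Longrightarrow> mdeg m \<le> N"
    and "\<And>i j k m. i \<ge> 1 \<Longrightarrow> j \<ge> 1 \<Longrightarrow> k \<ge> 1 \<Longrightarrow> f (swap_indets i j k m) = f m"
  using assms unfolding polysymmetric_def by blast

lemma mdeg_simps [simp]:
  "mdeg {#} = 0"
  "mdeg (a + b) = mdeg a + mdeg b"
  "mdeg (add_mset v a) = fst v + mdeg a"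
  "mdeg (repeat_mset r a) = r * mdeg a"
  unfolding mdeg_def by (auto simp: case_prod_unfold, induction r, auto)

lemma swap_indets_simps [simp]:
  "swap_indets i j k {#} = {#}"
  "swap_indets i j k (a + b) = swap_indets i j k a + swap_indets i j k b"
  "swap_indets i j k (repeat_mset r a) = repeat_mset r (swap_indets i j k a)"
  "swap_indets i j k (swap_indets i j k a) = a"
  unfolding swap_indets_def
  by (auto simp: multiset.map_comp o_def, induction r, auto)

lemma swap_indets_eq_iff [simp]: "swap_indets i j k a = swap_indets i j k b \<longleftrightarrow> a = b"
  by (metis swap_indets_simps(4))

lemma fst_transpose_indets [simp]: "fst (Transposition.transpose (i, j) (i, k) v) = fst v"
  by (auto simp: Transposition.transpose_def)

lemma mdeg_swap_indets [simp]: "mdeg (swap_indets i j k m) = mdeg m"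
  by (induction m) (auto simp: swap_indets_def)

lemma size_swap_indets [simp]: "size (swap_indets i j k m) = size m"
  by (simp add: swap_indets_def)

lemma transpose_in_indets_iff:
  assumes "i \<ge> 1" "j \<ge> 1" "k \<ge> 1"
  shows "Transposition.transpose (i, j) (i, k) v \<in> indets \<longleftrightarrow> v \<in> indets"
  using assms by (auto simp: indets_def Transposition.transpose_def)

lemma swap_indets_subset_iff:
  assumes "i \<ge> 1" "j \<ge> 1" "k \<ge> 1"
  shows "set_mset (swap_indets i j k m) \<subseteq> indets \<longleftrightarrow> set_mset m \<subseteq> indets"
  using transpose_in_indets_iff[OF assms]
  unfolding swap_indets_def set_image_mset image_subset_iff subset_eq by blast

lemma count_swap_indets:
  "count (swap_indets i j k m) v = count m (Transposition.transpose (i, j) (i, k) v)"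
proof -
  have eq: "Transposition.transpose (i, j) (i, k) u = v \<longleftrightarrow>
      u = Transposition.transpose (i, j) (i, k) v" for u
    by (metis transpose_involutory)
  show ?thesis unfolding swap_indets_def by (induction m) (simp_all add: eq)
qed

lemma squarefree_swap_indets [simp]:
  "squarefree_monom (swap_indets i j k m) \<longleftrightarrow> squarefree_monom m"
  unfolding squarefree_monom_def count_swap_indets by (metis transpose_involutory)

lemma ball_fst_swap_indets [simp]:
  "(\<forall>v\<in>#swap_indets i j k m. fst v = d) \<longleftrightarrow> (\<forall>v\<in>#m. fst v = d)"
  by (simp add: swap_indets_def)

lemma finite_submsets: "finite {a. a \<subseteq># (m :: 'a multiset)}"
proof (rule finite_subset)
  show "{a. a \<subseteq># m} \<subseteq> mset ` {xs. set xs \<subseteq> set_mset m \<and> length xs \<le> size m}"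
  proof
    fix a assume "a \<in> {a. a \<subseteq># m}"
    then have a: "a \<subseteq># m" by simp
    obtain xs where xs: "mset xs = a" using ex_mset by blast
    have "set xs \<subseteq> set_mset m" "length xs \<le> size m"
      using a xs by (auto dest: mset_subset_eqD size_mset_mono)
    with xs show "a \<in> mset ` {xs. set xs \<subseteq> set_mset m \<and> length xs \<le> size m}" by blast
  qed
  show "finite (mset ` {xs. set xs \<subseteq> set_mset m \<and> length xs \<le> size m})"
    by (intro finite_imageI finite_lists_length_le) simp
qed

lemma finite_msplits: "finite {(a, b). a + b = (m :: 'a multiset)}"
proof (rule finite_subset)
  show "{(a, b). a + b = m} \<subseteq> (\<lambda>a. (a, m - a)) ` {a. a \<subseteq># m}" by auto
qed (simp add: finite_submsets)

lemma finite_msplits': "finite {p. fst p + snd p = (m :: 'a multiset)}"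
  using finite_msplits[of m] by (simp add: case_prod_unfold)

typedef psym = "{f. polysymmetric f}"
  morphisms coeff Abs_psym
proof
  show "(\<lambda>_. 0) \<in> {f. polysymmetric f}" by (auto simp: polysymmetric_def)
qed

setup_lifting type_definition_psym

lemma psym_eqI: "(\<And>m. coeff f m = coeff g m) \<Longrightarrow> f = g"
  by (simp add: coeff_inject[symmetric] fun_eq_iff)

definition mconv :: "(monom \<Rightarrow> rat) \<Rightarrow> (monom \<Rightarrow> rat) \<Rightarrow> monom \<Rightarrow> rat" where
  "mconv f g m = (\<Sum>(a, b) | a + b = m. f a * g b)"

lemma mconv_nonzeroE:
  assumes "mconv f g m \<noteq> 0"
  obtains a b where "m = a + b" "f a \<noteq> 0" "g b \<noteq> 0"
proof -
  from assms obtain p where p: "p \<in> {(a, b). a + b = m}" "(case p of (a, b) \<Rightarrow> f a * g b) \<noteq> 0"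
    unfolding mconv_def by (rule sum.not_neutral_contains_not_neutral)
  obtain a b where "p = (a, b)" by (cases p)
  with p that show thesis by auto
qed

lemma mconv_commute: "mconv f g = mconv g f"
proof
  fix m
  show "mconv f g m = mconv g f m" unfolding mconv_def
    by (rule sum.reindex_bij_witness[of _ prod.swap prod.swap]) (auto simp: add.commute)
qed

lemma mconv_assoc: "mconv (mconv f g) h = mconv f (mconv g h)"
proof
  fix m
  have "mconv (mconv f g) h m =
      (\<Sum>(p, c) | p + c = m. \<Sum>(a, b) | a + b = p. f a * g b * h c)"
    by (simp add: mconv_def sum_distrib_right case_prod_unfold)
  also have "\<dots> = (\<Sum>((p, c), (a, b))\<in>Sigma {(p, c). p + c = m} (\<lambda>(p, c). {(a, b). a + b = p}).
      f a * g b * h c)"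
    by (subst sum.Sigma[symmetric]) (auto simp: finite_msplits' case_prod_unfold)
  also have "\<dots> = (\<Sum>((a, q), (b, c))\<in>Sigma {(a, q). a + q = m} (\<lambda>(a, q). {(b, c). b + c = q}).
      f a * (g b * h c))"
    by (rule sum.reindex_bij_witness
        [of _ "\<lambda>((a, q), (b, c)). ((a + b, c), (a, b))" "\<lambda>((p, c), (a, b)). ((a, b + c), (b, c))"])
      (clarsimp; simp add: add.assoc mult.assoc)+
  also have "\<dots> = (\<Sum>(a, q) | a + q = m. \<Sum>(b, c) | b + c = q. f a * (g b * h c))"
    by (subst sum.Sigma[symmetric]) (auto simp: finite_msplits' case_prod_unfold)
  also have "\<dots> = mconv f (mconv g h) m"
    by (simp add: mconv_def sum_distrib_left case_prod_unfold)
  finally show "mconv (mconv f g) h m = mconv f (mconv g h) m" .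
qed

lemma mconv_one: "mconv (\<lambda>m. of_bool (m = {#})) f = f"
proof
  fix m
  have "mconv (\<lambda>m. of_bool (m = {#})) f m = (\<Sum>(a, b)\<in>{({#} :: monom, m)}. of_bool (a = {#}) * f b)"
    unfolding mconv_def by (rule sum.mono_neutral_right) (auto simp: finite_msplits)
  then show "mconv (\<lambda>m. of_bool (m = {#})) f m = f m" by simp
qed

lemma mconv_add: "mconv (\<lambda>m. f m + g m) h m = mconv f h m + mconv g h m"
  by (simp add: mconv_def case_prod_unfold distrib_right sum.distrib)

lemma polysymmetric_mconv:
  assumes "polysymmetric f" "polysymmetric g"
  shows "polysymmetric (mconv f g)"
proof -
  obtain M where f: "\<And>m. f m \<noteq> 0 \<Longrightarrow> set_mset m \<subseteq> indets"
      "\<And>m. f m \<noteq> 0 \<Longrightarrow> mdeg m \<le> M"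
      "\<And>i j k m. i \<ge> 1 \<Longrightarrow> j \<ge> 1 \<Longrightarrow> k \<ge> 1 \<Longrightarrow> f (swap_indets i j k m) = f m"
    using assms(1) polysymmetricE by blast
  obtain N where g: "\<And>m. g m \<noteq> 0 \<Longrightarrow> set_mset m \<subseteq> indets"
      "\<And>m. g m \<noteq> 0 \<Longrightarrow> mdeg m \<le> N"
      "\<And>i j k m. i \<ge> 1 \<Longrightarrow> j \<ge> 1 \<Longrightarrow> k \<ge> 1 \<Longrightarrow> g (swap_indets i j k m) = g m"
    using assms(2) polysymmetricE by blast
  show ?thesis
  proof (rule polysymmetricI)
    fix m assume "mconv f g m \<noteq> 0"
    then obtain a b where ab: "m = a + b" "f a \<noteq> 0" "g b \<noteq> 0" by (rule mconv_nonzeroE)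
    show "set_mset m \<subseteq> indets" using f(1)[OF ab(2)] g(1)[OF ab(3)] ab(1) by simp
    show "mdeg m \<le> M + N" using f(2)[OF ab(2)] g(2)[OF ab(3)] ab(1) by simp
  next
    fix i j k :: nat and m assume ijk: "i \<ge> 1" "j \<ge> 1" "k \<ge> 1"
    let ?s = "swap_indets i j k"
    have eq: "?s a + ?s b = m \<longleftrightarrow> a + b = ?s m" for a b
      by (metis swap_indets_simps(2,4))
    show "mconv f g (?s m) = mconv f g m" unfolding mconv_def
      by (rule sum.reindex_bij_witness[of _ "map_prod ?s ?s" "map_prod ?s ?s"])
        (use ijk in \<open>auto simp: eq f(3) g(3) simp flip: swap_indets_simps(2)\<close>)
  qed
qed

lemma polysymmetric_add:
  assumes "polysymmetric f" "polysymmetric g"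
  shows "polysymmetric (\<lambda>m. f m + g m)"
proof -
  obtain M where f: "\<And>m. f m \<noteq> 0 \<Longrightarrow> set_mset m \<subseteq> indets"
      "\<And>m. f m \<noteq> 0 \<Longrightarrow> mdeg m \<le> M"
      "\<And>i j k m. i \<ge> 1 \<Longrightarrow> j \<ge> 1 \<Longrightarrow> k \<ge> 1 \<Longrightarrow> f (swap_indets i j k m) = f m"
    using assms(1) polysymmetricE by blast
  obtain N where g: "\<And>m. g m \<noteq> 0 \<Longrightarrow> set_mset m \<subseteq> indets"
      "\<And>m. g m \<noteq> 0 \<Longrightarrow> mdeg m \<le> N"
      "\<And>i j k m. i \<ge> 1 \<Longrightarrow> j \<ge> 1 \<Longrightarrow> k \<ge> 1 \<Longrightarrow> g (swap_indets i j k m) = g m"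
    using assms(2) polysymmetricE by blast
  show ?thesis
  proof (rule polysymmetricI)
    fix m assume "f m + g m \<noteq> 0"
    then consider "f m \<noteq> 0" | "g m \<noteq> 0" by fastforce
    then show "set_mset m \<subseteq> indets" "mdeg m \<le> max M N"
      using f(1,2)[of m] g(1,2)[of m] by (cases; auto)+
  qed (simp add: f(3) g(3))
qed

lemma polysymmetric_scale: "polysymmetric f \<Longrightarrow> polysymmetric (\<lambda>m. c * f m)"
  unfolding polysymmetric_def by auto

lemma polysymmetric_one: "polysymmetric (\<lambda>m. of_bool (m = {#}))"
proof (rule polysymmetricI[where N = 0])
  show "of_bool (swap_indets i j k m = {#}) = (of_bool (m = {#}) :: rat)" for i j k m
    by (simp add: swap_indets_def)
qed (auto split: if_splits)

instantiation psym :: comm_ring_1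
begin

lift_definition zero_psym :: psym is "\<lambda>_. 0" by (simp add: polysymmetric_def)
lift_definition one_psym :: psym is "\<lambda>m. of_bool (m = {#})" by (rule polysymmetric_one)
lift_definition plus_psym :: "psym \<Rightarrow> psym \<Rightarrow> psym" is "\<lambda>f g m. f m + g m"
  by (rule polysymmetric_add)
lift_definition uminus_psym :: "psym \<Rightarrow> psym" is "\<lambda>f m. - f m"
  by (simp add: polysymmetric_def)
definition minus_psym :: "psym \<Rightarrow> psym \<Rightarrow> psym" where "minus_psym f g = f + (- g)"
lift_definition times_psym :: "psym \<Rightarrow> psym \<Rightarrow> psym" is mconv
  by (rule polysymmetric_mconv)

instance
proof
  fix f g h :: psym
  show "f * g * h = f * (g * h)" by transfer (rule mconv_assoc)
  show "f * g = g * f" by transfer (rule mconv_commute)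
  show "1 * f = f" by transfer (rule mconv_one)
  show "(f + g) * h = f * h + g * h" by transfer (rule ext, rule mconv_add)
  show "f + g + h = f + (g + h)" by transfer (simp add: add.assoc)
  show "f + g = g + f" by transfer (simp add: add.commute)
  show "0 + f = f" by transfer simp
  show "- f + f = 0" by transfer simp
  show "f - g = f + - g" by (rule minus_psym_def)
  show "(0 :: psym) \<noteq> 1" by transfer (auto dest: fun_cong[where x = "{#}"])
qed

end

lift_definition scale_psym :: "rat \<Rightarrow> psym \<Rightarrow> psym" is "\<lambda>c f m. c * f m"
  by (rule polysymmetric_scale)

global_interpretation psym: vector_space scale_psym
proof unfold_locales
  fix a b :: rat and f g :: psym
  show "scale_psym a (f + g) = scale_psym a f + scale_psym a g"
    by transfer (simp add: distrib_left)
  show "scale_psym (a + b) f = scale_psym a f + scale_psym b f"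
    by transfer (simp add: distrib_right)
  show "scale_psym a (scale_psym b f) = scale_psym (a * b) f"
    by transfer (simp add: mult.assoc)
  show "scale_psym 1 f = f" by transfer simp
qed

section \<open>Types\<close>

definition composition :: "nat list \<Rightarrow> bool" where
  "composition \<beta> \<longleftrightarrow> 0 \<notin> set \<beta>"

abbreviation area :: "nat list \<Rightarrow> nat" where
  "area \<equiv> sum_list"

text \<open>
  In an ordered type, \<open>\<delta> i\<close> is the composition \<open>\<delta>|\<^sub>i\<close> for \<open>i \<ge> 1\<close>; the unused value \<open>\<delta> 0\<close> is
  normalised to the empty list.
\<close>

type_synonym otype = "nat \<Rightarrow> nat list"

definition osupp :: "otype \<Rightarrow> nat set" where
  "osupp \<delta> = {i. \<delta> i \<noteq> []}"

definition ordered_type :: "nat \<Rightarrow> otype \<Rightarrow> bool" where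
  "ordered_type n \<delta> \<longleftrightarrow> \<delta> 0 = [] \<and> (\<forall>i. composition (\<delta> i)) \<and> finite (osupp \<delta>) \<and>
     (\<Sum>i\<in>osupp \<delta>. i * area (\<delta> i)) = n"

definition oarea :: "otype \<Rightarrow> nat" where
  "oarea \<delta> = (\<Sum>i\<in>osupp \<delta>. area (\<delta> i))"

definition is_type :: "nat \<Rightarrow> otype \<Rightarrow> bool" where
  "is_type n \<tau> \<longleftrightarrow> ordered_type n \<tau> \<and> (\<forall>i. sorted_wrt (\<ge>) (\<tau> i))"

definition psort :: "otype \<Rightarrow> otype" where
  "psort \<delta> i = rev (sort (\<delta> i))"

text \<open>The block \<open>d\<^sup>r\<close> is the pair \<open>(d, r)\<close>.\<close>

definition blocks :: "otype \<Rightarrow> (nat \<times> nat) multiset" where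
  "blocks \<tau> = (\<Sum>d\<in>osupp \<tau>. {#(d, r). r \<in># mset (\<tau> d)#})"

definition OTyp :: "nat \<Rightarrow> nat \<Rightarrow> otype set" where
  "OTyp r n = {\<delta>. ordered_type n \<delta> \<and> (\<forall>i. r dvd area (\<delta> i))}"

section \<open>The polysymmetric functions $e^\otimes$ and $E^+$\<close>

text \<open>\<open>elem i k\<close> is the elementary symmetric function \<open>e\<^sub>k(x\<^sub>i\<^sub>1, x\<^sub>i\<^sub>2, \<dots>)\<close>.\<close>

lift_definition elem :: "nat \<Rightarrow> nat \<Rightarrow> psym" is
  "\<lambda>i k m. of_bool (set_mset m \<subseteq> indets \<and> squarefree_monom m \<and> size m = k \<and>
     (\<forall>v\<in>#m. fst v = i))"
proof -
  fix i k
  have "(\<forall>v\<in>#m. fst v = i) \<Longrightarrow> mdeg m = i * size m" for m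
    by (induction m) auto
  then show "polysymmetric (\<lambda>m. of_bool (set_mset m \<subseteq> indets \<and> squarefree_monom m \<and>
     size m = k \<and> (\<forall>v\<in>#m. fst v = i)))"
    by (intro polysymmetricI[where N = "i * k"])
      (simp_all add: swap_indets_subset_iff)
qed

definition e_tensor :: "otype \<Rightarrow> psym" where
  "e_tensor \<delta> = (\<Prod>i\<in>osupp \<delta>. \<Prod>k\<leftarrow>\<delta> i. elem i k)"

lift_definition Eplus :: "nat \<Rightarrow> psym" is
  "\<lambda>d m. of_bool (set_mset m \<subseteq> indets \<and> squarefree_monom m \<and> mdeg m = d)"
proof -
  fix d
  show "polysymmetric (\<lambda>m. of_bool (set_mset m \<subseteq> indets \<and> squarefree_monom m \<and> mdeg m = d))"
    by (rule polysymmetricI[where N = d]) (auto simp: swap_indets_subset_iff split: if_splits)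
qed

text \<open>
  \<open>power_subst r f\<close> replaces each \<open>x\<^sub>i\<^sub>j\<close> by \<open>x\<^sub>i\<^sub>j\<^sup>r\<close> in \<open>f\<close>, that is, each monomial \<open>m'\<close> by
  \<open>repeat_mset r m'\<close>. For \<open>r \<ge> 1\<close>, the only case used, the sum has at most one term.
\<close>

lift_definition power_subst :: "nat \<Rightarrow> psym \<Rightarrow> psym" is
  "\<lambda>r f m. \<Sum>m' | repeat_mset r m' = m. f m'"
proof -
  fix r and f :: "monom \<Rightarrow> rat" assume "polysymmetric f"
  then obtain M where f: "\<And>m. f m \<noteq> 0 \<Longrightarrow> set_mset m \<subseteq> indets"
      "\<And>m. f m \<noteq> 0 \<Longrightarrow> mdeg m \<le> M"
      "\<And>i j k m. i \<ge> 1 \<Longrightarrow> j \<ge> 1 \<Longrightarrow> k \<ge> 1 \<Longrightarrow> f (swap_indets i j k m) = f m"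
    using polysymmetricE by blast
  show "polysymmetric (\<lambda>m. \<Sum>m' | repeat_mset r m' = m. f m')"
  proof (rule polysymmetricI)
    fix m assume "(\<Sum>m' | repeat_mset r m' = m. f m') \<noteq> 0"
    then obtain m' where "m' \<in> {m'. repeat_mset r m' = m}" "f m' \<noteq> 0"
      by (rule sum.not_neutral_contains_not_neutral)
    then have m': "m = repeat_mset r m'" "f m' \<noteq> 0" by auto
    show "set_mset m \<subseteq> indets" using f(1)[OF m'(2)] m'(1)
      by (auto simp flip: count_greater_zero_iff)
    show "mdeg m \<le> r * M" using f(2)[OF m'(2)] m'(1) by simp
  next
    fix i j k :: nat and m assume ijk: "i \<ge> 1" "j \<ge> 1" "k \<ge> 1"
    let ?s = "swap_indets i j k"
    have eq: "repeat_mset r (?s a) = m \<longleftrightarrow> repeat_mset r a = ?s m" for a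
      by (metis swap_indets_simps(3,4))
    show "(\<Sum>m' | repeat_mset r m' = ?s m. f m') = (\<Sum>m' | repeat_mset r m' = m. f m')"
      by (rule sum.reindex_bij_witness[of _ ?s ?s])
        (auto simp: eq f(3)[OF ijk])
  qed
qed

definition E_type :: "otype \<Rightarrow> psym" where
  "E_type \<sigma> = (\<Prod>(d, r)\<in>#blocks \<sigma>. power_subst r (Eplus d))"

text \<open>
  The coefficient of \<open>e_tensor \<tau>\<close> when \<open>f\<close> is expanded in the basis of all \<open>e_tensor \<tau>\<close>,
  \<open>\<tau>\<close> a type of \<open>n\<close>, of the degree \<open>n\<close> part of \<open>psym\<close>.
\<close>

definition e_coeff :: "nat \<Rightarrow> psym \<Rightarrow> otype \<Rightarrow> rat" where
  "e_coeff n f \<tau> = psym.representation (e_tensor ` {\<tau>. is_type n \<tau>}) f (e_tensor \<tau>)"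

section \<open>The function $\hat{s}_r$\<close>

definition shat_tuple :: "nat \<Rightarrow> nat list \<Rightarrow> int" where
  "shat_tuple r w = (let v = (\<lambda>i. (w ! i + i) mod r) in
     if inj_on v {..<r} then (-1) ^ card {(i, j). i < j \<and> j < r \<and> v i > v j} else 0)"

definition shat_comp :: "nat \<Rightarrow> nat list \<Rightarrow> int" where
  "shat_comp r \<beta> = (if length \<beta> \<le> r
     then \<Sum>w | length w = r \<and> filter (\<lambda>x. x \<noteq> 0) w = \<beta>. shat_tuple r w else 0)"

text \<open>The factors for \<open>i \<notin> osupp \<delta>\<close> are omitted, as \<open>shat_comp r [] = 1\<close>.\<close>

definition shat :: "nat \<Rightarrow> otype \<Rightarrow> int" where
  "shat r \<delta> = (\<Prod>i\<in>osupp \<delta>. shat_comp r (\<delta> i))"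

lemma shat_comp_Nil: "shat_comp r [] = 1"
proof -
  have "{w. length w = r \<and> filter (\<lambda>x. x \<noteq> 0) w = []} = {replicate r (0::nat)}"
    by (auto simp: filter_empty_conv intro: replicate_eqI)
  moreover have "shat_tuple r (replicate r 0) = 1"
  proof -
    have "{(i, j). i < j \<and> j < r \<and> (replicate r 0 ! i + i) mod r > (replicate r 0 ! j + j) mod r} = {}"
      by auto
    moreover have "inj_on (\<lambda>i. (replicate r 0 ! i + i) mod r) {..<r}"
      by (auto intro!: inj_onI)
    ultimately show ?thesis unfolding shat_tuple_def Let_def by (simp only: if_True card.empty power_0)
  qed
  ultimately show ?thesis by (simp add: shat_comp_def)
qed

section \<open>Wrappings, polywrappings and tabloids\<close>

text \<open>
  A box is a pair (row, column), both counted from 0. \<open>sheet_column r t k p\<close> is the \<open>p\<close>-th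
  (from 0) column of \<open>k\<close>-sheets, in reading order, when the rows of an array with \<open>r\<close> columns are
  divided into \<open>k\<close>-sheets starting from row \<open>t\<close>.
\<close>

type_synonym box = "nat \<times> nat"

definition sheet_column :: "nat \<Rightarrow> nat \<Rightarrow> nat \<Rightarrow> nat \<Rightarrow> box set" where
  "sheet_column r t k p = {t + (p div r) * k ..< t + (p div r + 1) * k} \<times> {p mod r}"

text \<open>
  \<open>wrapping r t k \<beta>\<close> is the \<open>k\<close>-wrapping of content \<open>\<beta>\<close> of the \<open>k * area \<beta> div r\<close> rows starting
  at row \<open>t\<close>, as the list of its rectangles.
\<close>

definition wrapping :: "nat \<Rightarrow> nat \<Rightarrow> nat \<Rightarrow> nat list \<Rightarrow> box set list" where
  "wrapping r t k \<beta> = map (\<lambda>j. \<Union>p\<in>{area (take j \<beta>) ..< area (take (j + 1) \<beta>)}.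
     sheet_column r t k p) [0..<length \<beta>]"

text \<open>
  A polywrapping is given by the list \<open>D k\<close> of its rectangles of height \<open>k\<close>, for each \<open>k\<close>. (The
  height is not determined by the set of boxes: if \<open>r = 1\<close>, two boxes on top of each other can be
  a rectangle of height 1 or 2.)
\<close>

type_synonym polywrapping = "nat \<Rightarrow> box set list"

definition polywrap :: "nat \<Rightarrow> otype \<Rightarrow> polywrapping" where
  "polywrap r \<rho> k = wrapping r (\<Sum>i<k. i * area (\<rho> i) div r) k (\<rho> k)"

definition polywrappings :: "nat \<times> nat \<Rightarrow> polywrapping set" where
  "polywrappings = (\<lambda>(d, r). polywrap r ` OTyp r (d * r))"

text \<open>Each column of \<open>k\<close>-sheets has \<open>k\<close> boxes.\<close>

definition pocon :: "polywrapping \<Rightarrow> otype" where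
  "pocon D k = map (\<lambda>B. card B div k) (D k)"

definition bounded_polywrapping :: "nat \<Rightarrow> polywrapping \<Rightarrow> bool" where
  "bounded_polywrapping r D \<longleftrightarrow> (\<forall>k\<ge>1. length (D k) \<le> r)"

definition psgn :: "nat \<Rightarrow> polywrapping \<Rightarrow> int" where
  "psgn r D = (-1) ^ ((r - 1) * oarea (pocon D) div r) * shat r (pocon D)"

text \<open>The shape is given as a list \<open>bs\<close> of blocks.\<close>

definition tabloids :: "(nat \<times> nat) list \<Rightarrow> otype \<Rightarrow> polywrapping list set" where
  "tabloids bs \<tau> = {T. length T = length bs \<and>
     (\<forall>i<length bs. T ! i \<in> polywrappings (bs ! i) \<and> bounded_polywrapping (snd (bs ! i)) (T ! i)) \<and>
     (\<Sum>D\<leftarrow>T. blocks (psort (pocon D))) = blocks \<tau>}"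

definition psgn_tabloid :: "(nat \<times> nat) list \<Rightarrow> polywrapping list \<Rightarrow> int" where
  "psgn_tabloid bs T = (\<Prod>i<length bs. psgn (snd (bs ! i)) (T ! i))"

lemma card_sheet_columns:
  assumes "r \<ge> 1"
  shows "card (\<Union>p\<in>{a..<b}. sheet_column r t k p) = (b - a) * k"
proof -
  have disj: "sheet_column r t k p \<inter> sheet_column r t k q = {}" if "p \<noteq> q" for p q
  proof (rule ccontr)
    assume "sheet_column r t k p \<inter> sheet_column r t k q \<noteq> {}"
    then obtain x where x: "t + (p div r) * k \<le> x" "x < t + (p div r + 1) * k"
        "t + (q div r) * k \<le> x" "x < t + (q div r + 1) * k" and m: "p mod r = q mod r"
      by (auto simp: sheet_column_def)
    have "(p div r) * k < (q div r + 1) * k" "(q div r) * k < (p div r + 1) * k" using x by linarith+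
    then have "p div r = q div r" by (metis Suc_eq_plus1 less_Suc_eq_le le_antisym mult_less_cancel2)
    with m have "p = q" by (metis mult_div_mod_eq)
    with that show False by simp
  qed
  have "card (\<Union>p\<in>{a..<b}. sheet_column r t k p) = (\<Sum>p\<in>{a..<b}. card (sheet_column r t k p))"
    by (rule card_UN_disjoint) (use disj in \<open>auto simp: sheet_column_def\<close>)
  also have "\<dots> = (b - a) * k" by (simp add: sheet_column_def algebra_simps)
  finally show ?thesis .
qed

lemma pocon_polywrap:
  assumes "r \<ge> 1" "\<rho> \<in> OTyp r n"
  shows "pocon (polywrap r \<rho>) = \<rho>"
proof
  fix k
  have 0: "\<rho> 0 = []" using assms(2) by (simp add: OTyp_def ordered_type_def)
  show "pocon (polywrap r \<rho>) k = \<rho> k"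
  proof (cases "k = 0")
    case True
    then show ?thesis by (simp add: pocon_def polywrap_def wrapping_def 0)
  next
    case False
    then show ?thesis
      by (intro nth_equalityI)
        (auto simp: pocon_def polywrap_def wrapping_def card_sheet_columns[OF assms(1)]
          take_Suc_conv_app_nth)
  qed
qed

end

theory Submission
  imports Defs "Jordan_Normal_Form.Determinant" "HOL-Library.Poly_Mapping"
begin

text \<open>
  Let \<open>P\<close> be the cyclic shift of order \<open>r\<close>. The matrix \<open>\<Prod>\<^sub>v (1 + x\<^sub>v P) = \<Sum>\<^sub>k e\<^sub>k P\<^sup>k\<close> is a circulant
  matrix whose determinant is \<open>\<Prod>\<^sub>v (1 - (- x\<^sub>v)\<^sup>r)\<close>. Expanding this determinant over permutations
  gives \<open>\<Sum>\<^sub>w shat\<^sub>r(w) e\<^sub>w\<close>, the inversions in the definition of \<open>shat\<^sub>r\<close> being those of the permutation.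
  Comparing the parts of degree \<open>r a\<close> expresses \<open>e\<^sub>a(x\<^sup>r)\<close> through the \<open>e\<^sub>\<beta>\<close>. Since the generating function
  of the \<open>E\<^sup>+\<^sub>d\<close> is the product of \<open>1 + x\<^sub>i\<^sub>j\<close> over all \<open>i, j\<close>, this yields the expansion of each
  \<open>E\<^sup>+\<close> of a block as a signed sum over bounded polywrappings, and multiplying over the blocks
  gives tabloids. Finally, the \<open>e\<^sup>\<otimes>\<^sub>\<tau>\<close> are linearly independent, as they are triangular with
  respect to the dominance order on leading monomials.
\<close>

section \<open>The sign of a permutation by inversions\<close>

text \<open>Increasing gives \<open>i \<le> p i\<close> for all \<open>i < n\<close>. Both sides
  have the same sum, so no inequality is strict.\<close>

lemma permutes_increasing_imp_id:
  fixes n :: nat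
  assumes p: "p permutes {..<n}" and inc: "\<And>k. Suc k < n \<Longrightarrow> p k < p (Suc k)"
  shows "p = id"
proof
  fix x
  have ge: "i \<le> p i" if "i < n" for i
    using that
  proof (induction i)
    case (Suc i)
    then show ?case using inc[of i] by simp
  qed simp
  have "sum id {..<n} = sum p {..<n}"
    using sum.permute[OF p, of id] by simp
  then have "id i = p i" if "i < n" for i
    using sum_mono_inv[of id "{..<n}" p i] ge that by simp
  then show "p x = id x" using permutes_not_in[OF p, of x] by (cases "x < n") auto
qed

text \<open>Induction on the number of inversions: composing with the adjacent transposition at a
  descent removes exactly one inversion and flips the sign.\<close>

lemma sign_eq_inversions:
  fixes n :: nat
  assumes "p permutes {..<n}"
  shows "sign p = (-1) ^ card {(i, j). i < j \<and> j < n \<and> p i > p j}"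
  using assms
proof (induction "card {(i, j). i < j \<and> j < n \<and> p i > p j}" arbitrary: p rule: less_induct)
  case less
  define invs where "invs p = {(i, j). i < j \<and> j < n \<and> p i > (p j :: nat)}" for p
  have fin: "finite (invs p)" for p
    by (rule finite_subset[of _ "{..<n} \<times> {..<n}"]) (simp_all add: invs_def subset_iff)
  show ?case
  proof (cases "\<forall>k. Suc k < n \<longrightarrow> p k < p (Suc k)")
    case True
    then have "p = id" using permutes_increasing_imp_id[OF less.prems] by blast
    then have "{(i, j). i < j \<and> j < n \<and> p i > p j} = {}" by auto
    then show ?thesis using \<open>p = id\<close> by (simp only: sign_id card.empty power_0)
  next
    case False
    then obtain k where k: "Suc k < n" "\<not> p k < p (Suc k)" by blast
    have inj: "inj p" using less.prems by (rule permutes_inj)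
    from k inj have kk: "p (Suc k) < p k" by (metis inj_eq n_not_Suc_n nat_neq_iff)
    define t where "t = Transposition.transpose k (Suc k)"
    define q where "q = p \<circ> t"
    have tt: "t (t i) = i" for i by (simp add: t_def)
    have tp: "t permutes {..<n}" unfolding t_def using k by (intro permutes_swap_id) auto
    have qp: "q permutes {..<n}" unfolding q_def using tp less.prems by (rule permutes_compose)
    \<comment> \<open>The swap of \<open>k\<close> and \<open>Suc k\<close> reverses the order of
      this one pair only.\<close>
    have mono: "t i < t j" if "i < j" "(i, j) \<noteq> (k, Suc k)" for i j
      using that by (auto simp: t_def Transposition.transpose_def)
    have lt: "t i < n \<longleftrightarrow> i < n" for i using permutes_in_image[OF tp, of i] by simp
    \<comment> \<open>Applying \<open>t\<close> to both coordinates matches the inversions of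
      \<open>p\<close> other than \<open>(k, Suc k)\<close> with those of \<open>q\<close>.\<close>
    have bij: "bij_betw (map_prod t t) (invs p - {(k, Suc k)}) (invs q)"
    proof (rule bij_betw_byWitness[where f' = "map_prod t t"])
      show "map_prod t t ` (invs p - {(k, Suc k)}) \<subseteq> invs q"
        using mono lt by (auto simp: invs_def q_def tt)
      have "map_prod t t (i, j) \<in> invs p - {(k, Suc k)}" if ij: "(i, j) \<in> invs q" for i j
      proof -
        have ne: "(i, j) \<noteq> (k, Suc k)" using ij kk by (auto simp: invs_def q_def t_def)
        then have lt': "t i < t j" using mono ij by (auto simp: invs_def)
        have "t i = k \<and> t j = Suc k \<Longrightarrow> j < i"
          by (metis tt t_def transpose_apply_first transpose_apply_second lessI)
        then show ?thesis using ij lt' lt by (auto simp: invs_def q_def)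
      qed
      then show "map_prod t t ` invs q \<subseteq> invs p - {(k, Suc k)}" by auto
    qed (auto simp: tt)
    have "(k, Suc k) \<in> invs p" using k kk by (simp add: invs_def)
    then have card: "card (invs p) = Suc (card (invs q))"
      using bij_betw_same_card[OF bij] card_Suc_Diff1[OF fin] by metis
    have IH: "sign q = (-1) ^ card (invs q)"
      using less.hyps[of q] qp card unfolding invs_def by simp
    have pq: "p = q \<circ> t" by (auto simp: q_def tt)
    have "sign p = sign q * sign t"
      by (subst pq, rule sign_compose) (use qp tp in \<open>auto intro: permutation_permutes[THEN iffD2]\<close>)
    also have "\<dots> = (-1) ^ card (invs p)" by (simp add: IH card t_def sign_swap_id)
    finally show ?thesis by (simp add: invs_def)
  qed
qed

section \<open>Elementary symmetric polynomials and circulant determinants\<close>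

text \<open>The values lie in an arbitrary commutative ring, so that indeterminates, their powers
  and univariate monomials can all be substituted.\<close>

definition esym :: "'v set \<Rightarrow> ('v \<Rightarrow> 'a::comm_ring_1) \<Rightarrow> nat \<Rightarrow> 'a" where
  "esym V x k = (\<Sum>S | S \<subseteq> V \<and> card S = k. \<Prod>v\<in>S. x v)"

lemma esym_0 [simp]:
  assumes "finite V"
  shows "esym V x 0 = 1"
proof -
  have "{S. S \<subseteq> V \<and> card S = 0} = {{}}"
    using assms by (auto dest: finite_subset simp: card_eq_0_iff)
  then show ?thesis by (simp only: esym_def sum.insert) simp
qed

lemma esym_eq_0:
  assumes "finite V" "card V < k"
  shows "esym V x k = 0"
proof -
  have "{S. S \<subseteq> V \<and> card S = k} = {}"
    using assms card_mono[of V] by (auto simp: not_le[symmetric])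
  then show ?thesis by (simp only: esym_def sum.empty)
qed

text \<open>A subset of size \<open>Suc k\<close> either avoids \<open>v\<close> or is
  \<open>v\<close> together with a \<open>k\<close>-subset of \<open>V\<close>.\<close>

lemma esym_insert_Suc:
  assumes "finite V" "v \<notin> V"
  shows "esym (insert v V) x (Suc k) = esym V x (Suc k) + x v * esym V x k"
proof -
  have fin: "finite S" if "S \<subseteq> V" for S using that assms(1) by (rule finite_subset)
  have "{S. S \<subseteq> insert v V \<and> card S = Suc k} =
      {S. S \<subseteq> V \<and> card S = Suc k} \<union> insert v ` {S. S \<subseteq> V \<and> card S = k}" (is "?A = ?B \<union> ?C")
  proof (intro equalityI subsetI)
    fix S assume S: "S \<in> ?A"
    show "S \<in> ?B \<union> ?C"
    proof (cases "v \<in> S")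
      case True
      with S have "S - {v} \<subseteq> V" "card (S - {v}) = k" "S = insert v (S - {v})" by auto
      then show ?thesis by blast
    next
      case False
      with S show ?thesis by auto
    qed
  next
    fix S assume "S \<in> ?B \<union> ?C"
    then show "S \<in> ?A"
      using fin assms(2) by (auto simp: card_insert_if)
  qed
  moreover have "?B \<inter> ?C = {}" using assms(2) by auto
  moreover have "finite ?B" "finite ?C" using assms(1) by auto
  moreover have "inj_on (insert v) {S. S \<subseteq> V \<and> card S = k}"
    using assms(2) by (intro inj_onI) (metis (no_types, lifting) insert_ident mem_Collect_eq subsetD)
  moreover have "(\<Prod>u\<in>insert v S. x u) = x v * (\<Prod>u\<in>S. x u)" if "S \<subseteq> V" for S
    using that fin assms(2) by (subst prod.insert) auto
  ultimately show ?thesis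
    unfolding esym_def by (simp add: sum.union_disjoint sum.reindex sum_distrib_left)
qed

lemma esym_mult_const: "esym V (\<lambda>v. x v * t) k = esym V x k * t ^ k"
  unfolding esym_def by (simp add: prod.distrib sum_distrib_right)

text \<open>The generating function of the elementary symmetric polynomials. Any bound
  \<open>K\<close> of \<open>card V\<close> is allowed, so that sums for different \<open>V\<close>
  share one range.\<close>

lemma prod_one_plus_eq_sum_esym:
  assumes "finite V" "card V \<le> K"
  shows "(\<Prod>v\<in>V. 1 + x v * t) = (\<Sum>k\<le>K. esym V x k * t ^ k)"
  using assms
proof (induction V arbitrary: K)
  case empty
  have "(\<Sum>k\<le>K. esym {} x k * t ^ k) = (\<Sum>k\<in>{0}. esym {} x k * t ^ k)"
    by (rule sum.mono_neutral_right) (auto simp: esym_eq_0)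
  then show ?case by simp
next
  case (insert v V)
  then obtain L where K: "K = Suc L" and L: "card V \<le> L" by (cases K) auto
  have "(\<Sum>k\<le>K. esym (insert v V) x k * t ^ k) =
      1 + (\<Sum>k\<le>L. esym V x (Suc k) * t ^ Suc k) + x v * t * (\<Sum>k\<le>L. esym V x k * t ^ k)"
    using insert.hyps
    \<comment> \<open>The recurrence produces sums up to \<open>K\<close> and up to
      \<open>L = K - 1\<close>; the induction hypothesis serves both.\<close>
    by (simp add: K sum.atMost_Suc_shift esym_insert_Suc sum_distrib_left algebra_simps sum.distrib del: sum.atMost_Suc)
  also have "1 + (\<Sum>k\<le>L. esym V x (Suc k) * t ^ Suc k) = (\<Sum>k\<le>K. esym V x k * t ^ k)"
    using insert.hyps by (simp add: K sum.atMost_Suc_shift del: sum.atMost_Suc)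
  also have "\<dots> = (\<Prod>v\<in>V. 1 + x v * t)" using insert.IH[of K] L K by simp
  also have "(\<Sum>k\<le>L. esym V x k * t ^ k) = (\<Prod>v\<in>V. 1 + x v * t)" using insert.IH[of L] L by simp
  finally show ?case using insert.hyps by (simp add: algebra_simps)
qed

text \<open>
  With the cyclic shift \<open>P\<close> of order \<open>r\<close>, \<open>circulant r K c\<close> is \<open>\<Sum>k\<le>K. c\<^sub>k P\<^sup>k\<close> and
  \<open>cyclic_bidiag r a\<close> is \<open>1 + a P\<close>.
\<close>

definition circulant :: "nat \<Rightarrow> nat \<Rightarrow> (nat \<Rightarrow> 'a) \<Rightarrow> 'a::comm_ring_1 mat" where
  "circulant r K c = mat r r (\<lambda>(i, j). \<Sum>k\<le>K. if (k + i) mod r = j then c k else 0)"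

definition cyclic_bidiag :: "nat \<Rightarrow> 'a::comm_ring_1 \<Rightarrow> 'a mat" where
  "cyclic_bidiag r a = mat r r (\<lambda>(i, j). of_bool (i = j) + (if Suc i mod r = j then a else 0))"

lemma circulant_carrier [simp]: "circulant r K c \<in> carrier_mat r r"
  by (simp add: circulant_def)

lemma cyclic_bidiag_carrier [simp]: "cyclic_bidiag r a \<in> carrier_mat r r"
  by (simp add: cyclic_bidiag_def)

text \<open>This is the product of \<open>\<Sum>k\<le>K. c k P^k\<close> with
  \<open>1 + a P\<close>, carried out on matrix entries.\<close>

lemma circulant_mult_cyclic_bidiag:
  assumes r: "r \<ge> 1" and "c' 0 = c 0" "\<And>k. c' (Suc k) = c (Suc k) + a * c k" "c K = 0"
  shows "circulant r K c * cyclic_bidiag r a = circulant r K c'"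
proof (rule eq_matI)
  fix i j assume "i < dim_row (circulant r K c')" "j < dim_col (circulant r K c')"
  then have ij: "i < r" "j < r" by (simp_all add: circulant_def)
  define M where "M l = (\<Sum>k\<le>K. if (k + i) mod r = l then c k else 0)" for l
  have "(circulant r K c * cyclic_bidiag r a) $$ (i, j) =
      (\<Sum>l = 0..<r. M l * (of_bool (l = j) + (if Suc l mod r = j then a else 0)))"
    using ij by (simp add: circulant_def cyclic_bidiag_def scalar_prod_def M_def)
  also have "\<dots> = (\<Sum>l = 0..<r. if l = j then M l else 0) +
      (\<Sum>l = 0..<r. M l * (if Suc l mod r = j then a else 0))"
    by (subst sum.distrib[symmetric], rule sum.cong) (auto simp: distrib_left)
  also have "(\<Sum>l = 0..<r. if l = j then M l else 0) = M j" using ij by simp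
  also have "(\<Sum>l = 0..<r. M l * (if Suc l mod r = j then a else 0)) =
      (\<Sum>k\<le>K. \<Sum>l = 0..<r. if (k + i) mod r = l then c k * (if Suc l mod r = j then a else 0) else 0)"
    unfolding M_def sum_distrib_right by (subst sum.swap) (auto intro!: sum.cong)
  also have "\<dots> = (\<Sum>k\<le>K. if (Suc k + i) mod r = j then a * c k else 0)"
    using r by (intro sum.cong) (auto simp: mod_Suc_eq mult.commute)
  \<comment> \<open>Since \<open>c K = 0\<close>, the power \<open>P^(K+1)\<close>, which is outside
    the range of \<open>circulant r K\<close>, does not occur.\<close>
  also have "\<dots> = (\<Sum>k<K. if (Suc k + i) mod r = j then a * c k else 0)"
    using assms(4) by (simp add: lessThan_Suc_atMost[symmetric])
  also have "M j = (if i mod r = j then c 0 else 0) + (\<Sum>k<K. if (Suc k + i) mod r = j then c (Suc k) else 0)"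
    unfolding M_def lessThan_Suc_atMost[symmetric] by (subst sum.lessThan_Suc_shift) simp
  moreover have eq: "(\<Sum>k<K. if (Suc k + i) mod r = j then c (Suc k) else 0) +
      (\<Sum>k<K. if (Suc k + i) mod r = j then a * c k else 0) =
      (\<Sum>k<K. if (Suc k + i) mod r = j then c' (Suc k) else 0)"
    unfolding sum.distrib[symmetric] by (rule sum.cong) (simp_all add: assms(3))
  ultimately have "(circulant r K c * cyclic_bidiag r a) $$ (i, j) =
      (if i mod r = j then c 0 else 0) + (\<Sum>k<K. if (Suc k + i) mod r = j then c' (Suc k) else 0)"
    by (simp only: eq add.assoc)
  also have "\<dots> = circulant r K c' $$ (i, j)"
    using ij assms(2) unfolding circulant_def lessThan_Suc_atMost[symmetric]
    by (simp add: sum.lessThan_Suc_shift del: sum.lessThan_Suc)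
  finally show "(circulant r K c * cyclic_bidiag r a) $$ (i, j) = circulant r K c' $$ (i, j)" .
qed (simp_all add: circulant_def cyclic_bidiag_def)

text \<open>Laplace expansion along the first column, whose nonzero entries can only be in the first
  and the last row; the two minors are triangular.\<close>

lemma det_cyclic_bidiag:
  assumes r: "r \<ge> 1"
  shows "det (cyclic_bidiag r a) = 1 - (- a) ^ r"
\<comment> \<open>For \<open>r = 1\<close> the two entries fall into the same cell and give
  \<open>1 + a\<close>.\<close>
proof (cases "r = 1")
  case True
  then show ?thesis by (simp add: det_single cyclic_bidiag_def)
next
  case False
  then obtain q where q: "r = Suc (Suc q)" using r by (metis One_nat_def Suc_le_D old.nat.exhaust)
  let ?A = "cyclic_bidiag r a"
  have "det ?A = (\<Sum>i<r. ?A $$ (i, 0) * cofactor ?A i 0)"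
    by (rule laplace_expansion_column[OF cyclic_bidiag_carrier]) (use r in simp)
  also have "\<dots> = (\<Sum>i\<in>{0, Suc q}. ?A $$ (i, 0) * cofactor ?A i 0)"
    by (rule sum.mono_neutral_right) (auto simp: cyclic_bidiag_def q mod_Suc split: if_splits)
  also have "\<dots> = cofactor ?A 0 0 + a * cofactor ?A (Suc q) 0"
    by (simp add: cyclic_bidiag_def q)
  also have "cofactor ?A 0 0 = 1"
  proof -
    have "det (mat_delete ?A 0 0) = prod_list (diag_mat (mat_delete ?A 0 0))"
      by (rule det_upper_triangular[of _ "Suc q"])
        (auto simp: upper_triangular_def mat_delete_def cyclic_bidiag_def q mod_Suc split: if_splits)
    also have "diag_mat (mat_delete ?A 0 0) = replicate (Suc q) 1"
      by (rule nth_equalityI) (auto simp: diag_mat_def mat_delete_def cyclic_bidiag_def q mod_Suc simp del: upt_Suc replicate_Suc split: if_splits)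
    finally show ?thesis by (simp add: cofactor_def)
  qed
  also have "cofactor ?A (Suc q) 0 = (- 1) ^ Suc q * a ^ Suc q"
  proof -
    have "det (mat_delete ?A (Suc q) 0) = prod_list (diag_mat (mat_delete ?A (Suc q) 0))"
      by (rule det_lower_triangular[of "Suc q"])
        (auto simp: mat_delete_def cyclic_bidiag_def q mod_Suc split: if_splits)
    also have "diag_mat (mat_delete ?A (Suc q) 0) = replicate (Suc q) a"
      by (rule nth_equalityI) (auto simp: diag_mat_def mat_delete_def cyclic_bidiag_def q mod_Suc simp del: upt_Suc replicate_Suc split: if_splits)
    finally show ?thesis by (simp add: cofactor_def del: replicate_Suc)
  qed
  finally show ?thesis unfolding q power_minus[of a "Suc (Suc q)"] by simp
qed

text \<open>Each variable contributes a matrix factor \<open>1 + x v P\<close>, and determinants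
  multiply. The strict bound \<open>card V < K\<close> makes the coefficient at \<open>K\<close>
  vanish.\<close>

lemma det_circulant_esym:
  assumes "r \<ge> 1" "finite V" "card V < K"
  shows "det (circulant r K (esym V x)) = (\<Prod>v\<in>V. 1 - (- x v) ^ r)"
  using assms(2,3)
proof (induction V)
  case empty
  have "circulant r K (esym {} x) = 1\<^sub>m r"
  proof (rule eq_matI)
    fix i j assume ij: "i < dim_row (1\<^sub>m r)" "j < dim_col (1\<^sub>m r)"
    have "(\<Sum>k\<le>K. if (k + i) mod r = j then esym {} x k else 0) =
        (\<Sum>k\<in>{0}. if (k + i) mod r = j then esym {} x k else 0)"
      by (rule sum.mono_neutral_right) (auto simp: esym_eq_0)
    then show "circulant r K (esym {} x) $$ (i, j) = 1\<^sub>m r $$ (i, j)"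
      using ij by (simp add: circulant_def)
  qed (simp_all add: circulant_def)
  then show ?case by simp
next
  case (insert v V)
  have "circulant r K (esym (insert v V) x) = circulant r K (esym V x) * cyclic_bidiag r (x v)"
    by (rule circulant_mult_cyclic_bidiag[symmetric])
      (use insert assms(1) in \<open>simp_all add: esym_insert_Suc esym_eq_0\<close>)
  then show ?case
    using insert by (simp add: det_mult[of _ r] det_cyclic_bidiag[OF assms(1)] mult.commute)
qed

section \<open>Elementary symmetric polynomials of powers\<close>

text \<open>All values of \<open>p\<close> are prescribed, so at most one permutation qualifies. It
  exists exactly when the residues are distinct, and then its sign is given by its
  inversions.\<close>

lemma sum_sign_eq_shat_tuple:
  assumes "length w = r"
  shows "(\<Sum>p | p permutes {0..<r} \<and> (\<forall>i<r. p i = (w ! i + i) mod r). sign p) = shat_tuple r w"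
proof -
  define v where "v i = (w ! i + i) mod r" for i
  let ?P = "{p. p permutes {0..<r} \<and> (\<forall>i<r. p i = (w ! i + i) mod r)}"
  show ?thesis
  proof (cases "inj_on v {..<r}")
    case True
    define q where "q i = (if i < r then v i else i)" for i
    have "v ` {..<r} \<subseteq> {..<r}" by (auto simp: v_def)
    then have "bij_betw v {..<r} {..<r}" using True by (simp add: bij_betw_def endo_inj_surj)
    then have "bij_betw q {..<r} {..<r}"
      by (rule bij_betw_cong[THEN iffD1, rotated]) (simp add: q_def)
    then have q: "q permutes {..<r}" by (rule bij_imp_permutes) (simp add: q_def)
    have "?P = {q}"
    proof (intro equalityI subsetI)
      fix p assume p: "p \<in> ?P"
      have "p i = q i" for i
        using p permutes_not_in[of p "{0..<r}" i] by (cases "i < r") (auto simp: q_def v_def)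
      then show "p \<in> {q}" by auto
    qed (use q in \<open>auto simp: q_def v_def lessThan_atLeast0\<close>)
    moreover have "{(i, j). i < j \<and> j < r \<and> q i > q j} = {(i, j). i < j \<and> j < r \<and> v i > v j}"
      by (auto simp: q_def)
    ultimately show ?thesis
      using True sign_eq_inversions[OF q] by (simp add: shat_tuple_def v_def[abs_def])
  next
    case False
    have "?P = {}"
    proof (rule ccontr)
      assume "?P \<noteq> {}"
      then obtain p where p: "p permutes {0..<r}" "\<And>i. i < r \<Longrightarrow> p i = v i" by (auto simp: v_def)
      have "inj_on v {..<r}"
        using permutes_inj_on[OF p(1), of "{..<r}"] p(2) inj_on_cong[of "{..<r}" p v] by simp
      with False show False ..
    qed
    then show ?thesis using False by (simp only: sum.empty) (simp add: shat_tuple_def v_def[abs_def])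
  qed
qed

lemma bij_betw_PiE_lists:
  "bij_betw (\<lambda>g. map g [0..<r]) ({0..<r} \<rightarrow>\<^sub>E A) {w. length w = r \<and> set w \<subseteq> A}"
proof (rule bij_betw_byWitness[where f' = "\<lambda>w. restrict ((!) w) {0..<r}"])
  show "\<forall>g\<in>{0..<r} \<rightarrow>\<^sub>E A. restrict ((!) (map g [0..<r])) {0..<r} = g"
  proof
    fix g assume g: "g \<in> {0..<r} \<rightarrow>\<^sub>E A"
    show "restrict ((!) (map g [0..<r])) {0..<r} = g"
    proof
      fix i show "restrict ((!) (map g [0..<r])) {0..<r} i = g i"
        using PiE_arb[OF g, of i] by (cases "i < r") simp_all
    qed
  qed
  show "\<forall>w\<in>{w. length w = r \<and> set w \<subseteq> A}. map (restrict ((!) w) {0..<r}) [0..<r] = w"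
    by (intro ballI nth_equalityI) auto
  show "(\<lambda>g. map g [0..<r]) ` ({0..<r} \<rightarrow>\<^sub>E A) \<subseteq> {w. length w = r \<and> set w \<subseteq> A}"
  proof (intro image_subsetI CollectI conjI)
    fix g assume "g \<in> {0..<r} \<rightarrow>\<^sub>E A"
    then show "set (map g [0..<r]) \<subseteq> A"
      by (simp add: PiE_iff image_subset_iff)
  qed simp
  show "(\<lambda>w. restrict ((!) w) {0..<r}) ` {w. length w = r \<and> set w \<subseteq> A} \<subseteq> {0..<r} \<rightarrow>\<^sub>E A"
  proof (intro image_subsetI)
    fix w assume "w \<in> {w. length w = r \<and> set w \<subseteq> A}"
    then show "restrict ((!) w) {0..<r} \<in> {0..<r} \<rightarrow>\<^sub>E A"
      using nth_mem[of _ w] by (simp add: restrict_PiE_iff subset_iff)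
  qed
qed

text \<open>In the Leibniz formula, multiplying out the entries selects an exponent
  \<open>w ! i\<close> in each row. Summing over the permutations first leaves the signs of those
  compatible with \<open>w\<close>.\<close>

lemma det_circulant_expand:
  "det (circulant r K c) =
     (\<Sum>w | length w = r \<and> set w \<subseteq> {..K}. of_int (shat_tuple r w) * (\<Prod>k\<leftarrow>w. c k))"
proof -
  let ?P = "{p. p permutes {0..<r}}" and ?G = "{0..<r} \<rightarrow>\<^sub>E {..K}"
  let ?a = "\<lambda>p i k. if (k + i) mod r = p i then c k else 0"
  have fin: "finite ?P" by (rule finite_permutations) simp
  have "det (circulant r K c) = (\<Sum>p\<in>?P. signof p * (\<Prod>i = 0..<r. \<Sum>k\<le>K. ?a p i k))"
    unfolding det_def'[OF circulant_carrier]
  proof (intro sum.cong refl arg_cong2[where f = "(*)"] prod.cong)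
    fix p i assume "p \<in> ?P" "i \<in> {0..<r}"
    then show "circulant r K c $$ (i, p i) = (\<Sum>k\<le>K. ?a p i k)"
      using permutes_in_image[of p "{0..<r}" i] by (simp add: circulant_def)
  qed
  also have "\<dots> = (\<Sum>p\<in>?P. \<Sum>g\<in>?G. signof p * (\<Prod>i = 0..<r. ?a p i (g i)))"
    by (subst prod_sum_PiE) (simp_all add: sum_distrib_left)
  also have "\<dots> = (\<Sum>g\<in>?G. \<Sum>p\<in>?P. signof p * (\<Prod>i = 0..<r. ?a p i (g i)))"
    by (rule sum.swap)
  also have "\<dots> = (\<Sum>g\<in>?G. of_int (shat_tuple r (map g [0..<r])) * (\<Prod>k\<leftarrow>map g [0..<r]. c k))"
  proof (rule sum.cong[OF refl])
    fix g
    \<comment> \<open>A permutation contributes only if it sends every \<open>i\<close> to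
      \<open>(g i + i) mod r\<close>.\<close>
    have "(\<Sum>p\<in>?P. signof p * (\<Prod>i = 0..<r. ?a p i (g i))) =
        (\<Sum>p | p permutes {0..<r} \<and> (\<forall>i<r. p i = (map g [0..<r] ! i + i) mod r).
          signof p * (\<Prod>i = 0..<r. c (g i)))"
    proof (rule sum.mono_neutral_cong_right[OF fin])
      show "\<forall>p\<in>?P - {p. p permutes {0..<r} \<and> (\<forall>i<r. p i = (map g [0..<r] ! i + i) mod r)}.
          signof p * (\<Prod>i = 0..<r. ?a p i (g i)) = 0"
      proof
        fix p assume "p \<in> ?P - {p. p permutes {0..<r} \<and> (\<forall>i<r. p i = (map g [0..<r] ! i + i) mod r)}"
        then obtain i where "i < r" "p i \<noteq> (g i + i) mod r" by auto
        then have "(\<Prod>i = 0..<r. ?a p i (g i)) = 0" by (intro prod_zero bexI[of _ i]) auto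
        then show "signof p * (\<Prod>i = 0..<r. ?a p i (g i)) = 0" by simp
      qed
    qed (auto intro!: arg_cong2[where f = "(*)"] prod.cong)
    also have "\<dots> = of_int (\<Sum>p | p permutes {0..<r} \<and> (\<forall>i<r. p i = (map g [0..<r] ! i + i) mod r). sign p) *
        (\<Prod>i = 0..<r. c (g i))"
      by (simp only: sum_distrib_right of_int_sum)
    also have "(\<Prod>i = 0..<r. c (g i)) = (\<Prod>k\<leftarrow>map g [0..<r]. c k)"
      by (simp add: prod.distinct_set_conv_list[symmetric] comp_def)
    finally show "(\<Sum>p\<in>?P. signof p * (\<Prod>i = 0..<r. ?a p i (g i))) =
        of_int (shat_tuple r (map g [0..<r])) * (\<Prod>k\<leftarrow>map g [0..<r]. c k)"
      by (simp only: sum_sign_eq_shat_tuple[of "map g [0..<r]" r] length_map length_upt diff_zero)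
  qed
  also have "\<dots> = (\<Sum>w | length w = r \<and> set w \<subseteq> {..K}. of_int (shat_tuple r w) * (\<Prod>k\<leftarrow>w. c k))"
    by (rule sum.reindex_bij_betw[OF bij_betw_PiE_lists])
  finally show ?thesis .
qed

section \<open>Recording degrees by the exponent of an extra variable\<close>

lemma prod_list_monom: "(\<Prod>k\<leftarrow>w. monom (c k) k) = monom (\<Prod>k\<leftarrow>w. c k) (sum_list w)"
  by (induction w) (simp_all add: mult_monom)

lemma prod_monom:
  "(\<Prod>v\<in>S. monom (f v) (g v)) = monom (\<Prod>v\<in>S. f v) (\<Sum>v\<in>S. g v)"
  by (induction S rule: infinite_finite_induct) (simp_all add: mult_monom)

lemma esym_monom: "esym V (\<lambda>v. monom (x v) n) k = monom (esym V x k) (n * k)"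
  by (simp add: esym_def prod_monom monom_sum mult.commute)

text \<open>Each \<open>x v\<close> is multiplied by an extra variable, and the coefficient of its
  power \<open>r * a\<close> is compared in the two evaluations of the circulant
  determinant.\<close>

lemma esym_power_tuples:
  fixes x :: "'v \<Rightarrow> 'a::comm_ring_1"
  assumes r: "r \<ge> 1" and V: "finite V"
  shows "esym V (\<lambda>v. x v ^ r) a = (-1) ^ ((r - 1) * a) *
    (\<Sum>w | length w = r \<and> sum_list w = r * a. of_int (shat_tuple r w) * (\<Prod>k\<leftarrow>w. esym V x k))"
proof -
  \<comment> \<open>Larger than \<open>card V\<close> for the determinant formula, and at least
    \<open>r * a\<close> so that every tuple of that sum has its entries in
    \<open>{..K}\<close>.\<close>
  define K where "K = Suc (card V + r * a)"
  \<comment> \<open>With this sign, \<open>1 - (- y)^r = 1 + s y^r\<close>.\<close>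
  define s :: 'a where "s = (-1) ^ (r - 1)"
  let ?W = "{w. length w = r \<and> set w \<subseteq> {..K}}"
  have finW: "finite ?W"
    using finite_lists_length_eq[of "{..K}" r] by (simp add: conj_commute)
  have s: "- ((- y) ^ r) = y ^ r * s" for y :: 'a
    using r by (cases r) (simp_all add: s_def power_minus[of y])
  have "(\<Prod>v\<in>V. 1 - (- monom (x v) 1) ^ r) = (\<Prod>v\<in>V. 1 + monom (x v ^ r * s) r * 1)"
  proof (rule prod.cong[OF refl])
    fix v
    have "- ((- monom (x v) 1) ^ r) = monom (x v ^ r * s) r"
      by (simp add: minus_monom monom_power s)
    then show "1 - (- monom (x v) 1) ^ r = 1 + monom (x v ^ r * s) r * 1"
      by (simp only: diff_conv_add_uminus mult_1_right)
  qed
  also have "\<dots> = (\<Sum>k\<le>K. monom (esym V (\<lambda>v. x v ^ r) k * s ^ k) (r * k))"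
    by (subst prod_one_plus_eq_sum_esym[of _ K]) (use V in \<open>simp_all add: K_def esym_monom esym_mult_const\<close>)
  also have "poly.coeff \<dots> (r * a) =
      (\<Sum>k\<le>K. if k = a then esym V (\<lambda>v. x v ^ r) a * s ^ a else 0)"
    unfolding coeff_sum using r by (intro sum.cong) auto
  also have "\<dots> = esym V (\<lambda>v. x v ^ r) a * s ^ a"
  proof -
    have "a \<le> r * a" using r by simp
    then have "a \<le> K" unfolding K_def by linarith
    then show ?thesis by simp
  qed
  finally have "esym V (\<lambda>v. x v ^ r) a * s ^ a =
      poly.coeff (det (circulant r K (esym V (\<lambda>v. monom (x v) 1)))) (r * a)"
    using det_circulant_esym[OF r V, of K "\<lambda>v. monom (x v) 1"] by (simp add: K_def)
  also have "det (circulant r K (esym V (\<lambda>v. monom (x v) 1))) =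
      (\<Sum>w\<in>?W. monom (of_int (shat_tuple r w) * (\<Prod>k\<leftarrow>w. esym V x k)) (sum_list w))"
  proof -
    have "esym V (\<lambda>v. monom (x v) 1) = (\<lambda>k. monom (esym V x k) k)"
      using esym_monom[of V x 1] by (simp add: fun_eq_iff)
    then show ?thesis
      by (simp only: det_circulant_expand prod_list_monom of_int_monom mult_monom add_0)
  qed
  also have "poly.coeff \<dots> (r * a) =
      (\<Sum>w | w \<in> ?W \<and> sum_list w = r * a. of_int (shat_tuple r w) * (\<Prod>k\<leftarrow>w. esym V x k))"
    unfolding coeff_sum coeff_monom by (rule sum.inter_filter[OF finW, symmetric])
  also have "{w. w \<in> ?W \<and> sum_list w = r * a} = {w. length w = r \<and> sum_list w = r * a}"
  proof -
    have "k \<le> K" if "sum_list w = r * a" "k \<in> set w" for w k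
      using member_le_sum_list[OF that(2)] that(1) by (simp add: K_def)
    then show ?thesis by auto
  qed
  \<comment> \<open>Since \<open>s ^ a\<close> is its own inverse, multiplying by it moves the sign
    to the other side.\<close>
  finally have "s ^ a * (esym V (\<lambda>v. x v ^ r) a * s ^ a) = s ^ a *
    (\<Sum>w | length w = r \<and> sum_list w = r * a. of_int (shat_tuple r w) * (\<Prod>k\<leftarrow>w. esym V x k))"
    by simp
  moreover have "s ^ a * s ^ a = 1"
    by (simp add: s_def flip: power_mult_distrib)
  moreover have "s ^ a = (-1) ^ ((r - 1) * a)" by (simp add: s_def power_mult)
  ultimately show ?thesis by (simp add: mult.left_commute)
qed

lemma finite_lists_sum_eq: "finite {w :: nat list. length w = r \<and> sum_list w = n}"
  by (rule finite_subset[OF _ finite_lists_length_eq[of "{..n}" r]]) (auto dest: member_le_sum_list)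

lemma sum_list_filter_nonzero: "sum_list (filter (\<lambda>k. k \<noteq> (0::nat)) w) = sum_list w"
  by (induction w) auto

section \<open>From tuples with zeros to compositions\<close>

definition bounded_comps :: "nat \<Rightarrow> nat \<Rightarrow> nat list set" where
  "bounded_comps r n = {\<beta>. composition \<beta> \<and> length \<beta> \<le> r \<and> area \<beta> = n}"

lemma finite_bounded_comps: "finite (bounded_comps r n)"
proof (rule finite_subset)
  show "bounded_comps r n \<subseteq> {\<beta>. set \<beta> \<subseteq> {..n} \<and> length \<beta> \<le> r}"
    by (auto simp: bounded_comps_def dest: member_le_sum_list)
qed (simp add: finite_lists_length_le)

text \<open>The tuples are grouped by the composition that remains after deleting zeros; the signs
  in each group add up to \<open>shat_comp\<close>.\<close>

lemma esym_power_comps: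
  fixes x :: "'v \<Rightarrow> 'a::comm_ring_1"
  assumes r: "r \<ge> 1" and V: "finite V"
  shows "esym V (\<lambda>v. x v ^ r) a = (-1) ^ ((r - 1) * a) *
    (\<Sum>\<beta>\<in>bounded_comps r (r * a). of_int (shat_comp r \<beta>) * (\<Prod>k\<leftarrow>\<beta>. esym V x k))"
proof -
  let ?nz = "filter (\<lambda>k. k \<noteq> (0::nat))"
  let ?W = "{w. length w = r \<and> sum_list w = r * a}"
  \<comment> \<open>A zero entry stands for the factor \<open>esym V x 0 = 1\<close>.\<close>
  have prod_nz: "(\<Prod>k\<leftarrow>?nz w. esym V x k) = (\<Prod>k\<leftarrow>w. esym V x k)" for w
    using V by (induction w) auto
  have sub: "?nz ` ?W \<subseteq> bounded_comps r (r * a)"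
    by (auto simp: bounded_comps_def composition_def sum_list_filter_nonzero
        simp del: neq0_conv intro: order_trans[OF length_filter_le])
  have "(\<Sum>w\<in>?W. of_int (shat_tuple r w) * (\<Prod>k\<leftarrow>w. esym V x k)) =
      (\<Sum>\<beta>\<in>bounded_comps r (r * a). \<Sum>w | w \<in> ?W \<and> ?nz w = \<beta>.
        of_int (shat_tuple r w) * (\<Prod>k\<leftarrow>w. esym V x k))"
    by (intro sum.group[symmetric] sub finite_lists_sum_eq finite_bounded_comps)
  also have "\<dots> = (\<Sum>\<beta>\<in>bounded_comps r (r * a). of_int (shat_comp r \<beta>) * (\<Prod>k\<leftarrow>\<beta>. esym V x k))"
  proof (rule sum.cong[OF refl])
    fix \<beta> assume \<beta>: "\<beta> \<in> bounded_comps r (r * a)"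
    then have "{w. w \<in> ?W \<and> ?nz w = \<beta>} = {w. length w = r \<and> ?nz w = \<beta>}"
      using sum_list_filter_nonzero by (auto simp: bounded_comps_def simp del: neq0_conv)
    then have "(\<Sum>w | w \<in> ?W \<and> ?nz w = \<beta>. of_int (shat_tuple r w) * (\<Prod>k\<leftarrow>w. esym V x k)) =
        (\<Sum>w | length w = r \<and> ?nz w = \<beta>. of_int (shat_tuple r w) * (\<Prod>k\<leftarrow>\<beta>. esym V x k))"
    proof (intro sum.cong refl)
      fix w assume "w \<in> {w. length w = r \<and> ?nz w = \<beta>}"
      then have "?nz w = \<beta>" by blast
      with prod_nz[of w] show "of_int (shat_tuple r w) * (\<Prod>k\<leftarrow>w. esym V x k) =
          of_int (shat_tuple r w) * (\<Prod>k\<leftarrow>\<beta>. esym V x k)"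
        by (simp only:)
    qed assumption
    also have "\<dots> = of_int (shat_comp r \<beta>) * (\<Prod>k\<leftarrow>\<beta>. esym V x k)"
      using \<beta> by (simp add: shat_comp_def bounded_comps_def sum_distrib_right)
    finally show "(\<Sum>w | w \<in> ?W \<and> ?nz w = \<beta>. of_int (shat_tuple r w) * (\<Prod>k\<leftarrow>w. esym V x k)) =
        of_int (shat_comp r \<beta>) * (\<Prod>k\<leftarrow>\<beta>. esym V x k)" .
  qed
  finally show ?thesis using esym_power_tuples[OF r V, of x a] by simp
qed

section \<open>Square-free monomials of a given degree\<close>

text \<open>The ordered contents of the \<open>r\<close>-bounded polywrappings of the block
  \<open>(d, r)\<close>.\<close>

definition bounded_otypes :: "nat \<Rightarrow> nat \<Rightarrow> otype set" where
  "bounded_otypes r d = {\<rho> \<in> OTyp r (d * r). \<forall>k. length (\<rho> k) \<le> r}"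

text \<open>\<open>opsgn r \<rho>\<close> is the sign of the polywrapping with ordered content \<open>\<rho>\<close>.\<close>

definition opsgn :: "nat \<Rightarrow> otype \<Rightarrow> int" where
  "opsgn r \<rho> = (-1) ^ ((r - 1) * oarea \<rho> div r) * shat r \<rho>"

text \<open>A finite set of candidates for one component of an element of
  \<open>bounded_otypes\<close>; finiteness allows products of sums over it to be multiplied
  out.\<close>

definition bounded_dvd_comps :: "nat \<Rightarrow> nat \<Rightarrow> nat list set" where
  "bounded_dvd_comps r K = (\<Union>a\<in>{..K}. bounded_comps r (r * a))"

lemma finite_bounded_dvd_comps: "finite (bounded_dvd_comps r K)"
  by (simp add: bounded_dvd_comps_def finite_bounded_comps)

text \<open>For \<open>r \<ge> 1\<close> the area of a composition determines \<open>a\<close>, so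
  the union is disjoint.\<close>

lemma sum_bounded_dvd_comps:
  assumes "r \<ge> 1"
  shows "(\<Sum>\<beta>\<in>bounded_dvd_comps r K. f \<beta>) = (\<Sum>a\<le>K. \<Sum>\<beta>\<in>bounded_comps r (r * a). f \<beta>)"
  unfolding bounded_dvd_comps_def
  by (rule sum.UNION_disjoint) (use assms finite_bounded_comps in \<open>auto simp: bounded_comps_def\<close>)

text \<open>Presents ordered types as choice functions on \<open>{1..N}\<close>, the form in which
  they arise from multiplying out a product of sums.\<close>

lemma bounded_otypes_iff:
  assumes r: "r \<ge> 1" and "d \<le> N" "d \<le> K"
  shows "\<rho> \<in> bounded_otypes r d \<longleftrightarrow> (\<forall>i. i \<notin> {1..N} \<longrightarrow> \<rho> i = []) \<and>
    (\<forall>i\<in>{1..N}. \<rho> i \<in> bounded_dvd_comps r K) \<and> (\<Sum>i\<in>{1..N}. i * (area (\<rho> i) div r)) = d"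
    (is "_ \<longleftrightarrow> ?supp \<and> ?mem \<and> ?sum")
proof
  assume "\<rho> \<in> bounded_otypes r d"
  then have 0: "\<rho> 0 = []" and comp: "\<And>i. composition (\<rho> i)" and fin: "finite (osupp \<rho>)"
    and sum: "(\<Sum>i\<in>osupp \<rho>. i * area (\<rho> i)) = d * r" and dvd: "\<And>i. r dvd area (\<rho> i)"
    and len: "\<And>i. length (\<rho> i) \<le> r"
    by (auto simp: bounded_otypes_def OTyp_def ordered_type_def)
  \<comment> \<open>For a nonempty component, \<open>i\<close> and
    \<open>area (\<rho> i) div r\<close> are at least 1 with product at most \<open>d\<close>, so
    each of them is at most \<open>d\<close>.\<close>
  have bd: "i * (area (\<rho> i) div r) \<le> d" "1 \<le> i" "1 \<le> area (\<rho> i) div r" if "\<rho> i \<noteq> []" for i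
  proof -
    have "i * area (\<rho> i) \<le> d * r"
      using that fin unfolding sum[symmetric] by (intro member_le_sum) (auto simp: osupp_def)
    then show "i * (area (\<rho> i) div r) \<le> d"
      using dvd[of i] r by (auto elim!: dvdE)
    show "1 \<le> i" using that 0 by (cases i) auto
    have "area (\<rho> i) \<noteq> 0" using that comp[of i] by (cases "\<rho> i") (auto simp: composition_def)
    then have "area (\<rho> i) div r \<noteq> 0" using dvd[of i] by (metis dvd_div_eq_0_iff)
    then show "1 \<le> area (\<rho> i) div r" by simp
  qed
  have supp: ?supp
  proof (intro allI impI)
    fix i assume i: "i \<notin> {1..N}"
    show "\<rho> i = []"
    proof (rule ccontr)
      assume "\<rho> i \<noteq> []"
      from bd[OF this] have "i \<le> d" by (metis le_trans mult_le_mono2 nat_mult_1_right)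
      with i bd(2)[OF \<open>\<rho> i \<noteq> []\<close>] assms(2) show False by simp
    qed
  qed
  have mem: ?mem
  proof
    fix i
    have "area (\<rho> i) div r \<le> d"
    proof (cases "\<rho> i = []")
      case False
      from bd[OF this] show ?thesis by (metis le_trans mult_le_mono1 nat_mult_1)
    qed simp
    moreover have "area (\<rho> i) = r * (area (\<rho> i) div r)" using dvd[of i] by simp
    ultimately show "\<rho> i \<in> bounded_dvd_comps r K"
      using assms(3) comp[of i] len[of i] unfolding bounded_dvd_comps_def bounded_comps_def
      by (intro UN_I[of "area (\<rho> i) div r"]) auto
  qed
  have "(\<Sum>i\<in>{1..N}. i * (area (\<rho> i) div r)) * r = (\<Sum>i\<in>{1..N}. i * area (\<rho> i))"
    using dvd by (simp add: sum_distrib_right mult.assoc)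
  also have "\<dots> = d * r"
    unfolding sum[symmetric] by (rule sum.mono_neutral_right) (use supp in \<open>auto simp: osupp_def\<close>)
  finally have ?sum using r by simp
  with supp mem show "?supp \<and> ?mem \<and> ?sum" by blast
next
  assume asm: "?supp \<and> ?mem \<and> ?sum"
  then have props: "composition (\<rho> i) \<and> length (\<rho> i) \<le> r \<and> r dvd area (\<rho> i)" for i
  proof (cases "i \<in> {1..N}")
    case True
    with asm have "\<rho> i \<in> bounded_dvd_comps r K" by blast
    then show ?thesis by (auto simp: bounded_dvd_comps_def bounded_comps_def)
  next
    case False
    with asm have "\<rho> i = []" by blast
    then show ?thesis by (simp add: composition_def)
  qed
  have sub: "osupp \<rho> \<subseteq> {1..N}" using asm by (auto simp: osupp_def)
  have "(\<Sum>i\<in>osupp \<rho>. i * area (\<rho> i)) = (\<Sum>i\<in>{1..N}. i * area (\<rho> i))"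
    by (rule sum.mono_neutral_left) (use sub in \<open>auto simp: osupp_def\<close>)
  also have "\<dots> = (\<Sum>i\<in>{1..N}. i * (area (\<rho> i) div r)) * r"
    using props by (simp add: sum_distrib_right mult.assoc)
  also have "\<dots> = d * r" using asm by simp
  finally show "\<rho> \<in> bounded_otypes r d"
    using props asm finite_subset[OF sub] by (auto simp: bounded_otypes_def OTyp_def ordered_type_def)
qed

lemma finite_bounded_otypes:
  assumes "r \<ge> 1"
  shows "finite (bounded_otypes r d)"
proof (rule finite_subset)
  let ?F = "{f. \<forall>i. (i \<in> {1..d} \<longrightarrow> f i \<in> bounded_dvd_comps r d) \<and> (i \<notin> {1..d} \<longrightarrow> f i = [])}"
  show "bounded_otypes r d \<subseteq> ?F"
    using bounded_otypes_iff[OF assms order_refl order_refl, of _ d] by blast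
  show "finite ?F"
    by (rule finite_set_of_finite_funs) (simp_all add: finite_bounded_dvd_comps)
qed

definition esym_comp :: "'v set \<Rightarrow> ('v \<Rightarrow> 'a::comm_ring_1) \<Rightarrow> nat list \<Rightarrow> 'a" where
  "esym_comp V x \<beta> = (\<Prod>k\<leftarrow>\<beta>. esym V x k)"

text \<open>Divisibility by \<open>r\<close> splits the exponent of the sign into a sum over the
  components. Empty components contribute 1, so \<open>I\<close> may exceed the support.\<close>

lemma opsgn_eq_prod:
  assumes "finite I" "osupp \<rho> \<subseteq> I" "\<And>i. r dvd area (\<rho> i)"
  shows "opsgn r \<rho> = (\<Prod>i\<in>I. (-1) ^ ((r - 1) * (area (\<rho> i) div r)) * shat_comp r (\<rho> i))"
proof -
  have "oarea \<rho> = (\<Sum>i\<in>I. area (\<rho> i))"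
    unfolding oarea_def by (rule sum.mono_neutral_left) (use assms in \<open>auto simp: osupp_def\<close>)
  also have "\<dots> = r * (\<Sum>i\<in>I. area (\<rho> i) div r)"
    using assms(3) by (simp add: sum_distrib_left)
  finally have "(r - 1) * oarea \<rho> = r * (\<Sum>i\<in>I. (r - 1) * (area (\<rho> i) div r))"
    by (simp only: sum_distrib_left mult.left_commute)
  then have "(r - 1) * oarea \<rho> div r = (\<Sum>i\<in>I. (r - 1) * (area (\<rho> i) div r))"
    by (cases "r = 0") simp_all
  moreover have "shat r \<rho> = (\<Prod>i\<in>I. shat_comp r (\<rho> i))"
    unfolding shat_def
    by (rule prod.mono_neutral_left) (use assms in \<open>auto simp: osupp_def shat_comp_Nil\<close>)
  ultimately show ?thesis by (simp add: opsgn_def prod.distrib power_sum)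
qed

text \<open>The left side is the coefficient of degree \<open>d\<close> in the product of all
  \<open>1 + x v ^ r X^(fst v)\<close>. The factors are grouped by \<open>i = fst v\<close>, each
  group is expanded by \<open>esym_power_comps\<close>, and the result is multiplied out.\<close>

lemma sum_subsets_power_eq_sum_otypes:
  fixes x :: "nat \<times> 'v \<Rightarrow> 'a::comm_ring_1"
  assumes r: "r \<ge> 1" and V: "finite V" "\<And>v. v \<in> V \<Longrightarrow> fst v \<ge> 1"
  shows "(\<Sum>S | S \<subseteq> V \<and> (\<Sum>v\<in>S. fst v) = d. \<Prod>v\<in>S. x v ^ r) =
    (\<Sum>\<rho>\<in>bounded_otypes r d. of_int (opsgn r \<rho>) *
      (\<Prod>i\<in>osupp \<rho>. esym_comp {v\<in>V. fst v = i} x (\<rho> i)))"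
proof -
  \<comment> \<open>\<open>N\<close> bounds \<open>d\<close> and all degrees \<open>fst v\<close>;
    \<open>K\<close> bounds \<open>d\<close> and the number of variables in each group.\<close>
  define N where "N = d + (\<Sum>v\<in>V. fst v)"
  define K where "K = d + card V"
  define c :: "nat \<Rightarrow> nat list \<Rightarrow> 'a" where
    "c i \<beta> = of_int ((-1) ^ ((r - 1) * (area \<beta> div r)) * shat_comp r \<beta>) * esym_comp {v\<in>V. fst v = i} x \<beta>" for i \<beta>
  let ?I = "{1..N}" and ?C = "bounded_dvd_comps r K"
  let ?wt = "\<lambda>g. \<Sum>i\<in>?I. i * (area (g i) div r)"
  have c_Nil: "c i [] = 1" for i by (simp add: c_def shat_comp_Nil esym_comp_def)
  have fst_le: "fst v \<le> N" if "v \<in> V" for v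
    using member_le_sum[of v V fst] that V(1) by (simp add: N_def)
  have block: "(\<Prod>v\<in>{v\<in>V. fst v = i}. 1 + monom (x v ^ r) (fst v)) =
      (\<Sum>\<beta>\<in>?C. monom (c i \<beta>) (i * (area \<beta> div r)))" for i
  proof -
    let ?V = "{v\<in>V. fst v = i}"
    have fin: "finite ?V" and card: "card ?V \<le> K"
      using V(1) card_mono[of V ?V] by (auto simp: K_def)
    have "(\<Prod>v\<in>?V. 1 + monom (x v ^ r) (fst v)) = (\<Prod>v\<in>?V. 1 + monom (x v ^ r) i * 1)"
      by (rule prod.cong) simp_all
    also have "\<dots> = (\<Sum>a\<le>K. monom (esym ?V (\<lambda>v. x v ^ r) a) (i * a))"
      unfolding prod_one_plus_eq_sum_esym[OF fin card] esym_monom by simp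
    also have "\<dots> = (\<Sum>a\<le>K. \<Sum>\<beta>\<in>bounded_comps r (r * a). monom (c i \<beta>) (i * (area \<beta> div r)))"
    proof (rule sum.cong[OF refl])
      fix a
      have "esym ?V (\<lambda>v. x v ^ r) a = (\<Sum>\<beta>\<in>bounded_comps r (r * a). c i \<beta>)"
        unfolding esym_power_comps[OF r fin] sum_distrib_left c_def esym_comp_def
        using r by (intro sum.cong) (auto simp: bounded_comps_def mult.assoc)
      then show "monom (esym ?V (\<lambda>v. x v ^ r) a) (i * a) =
          (\<Sum>\<beta>\<in>bounded_comps r (r * a). monom (c i \<beta>) (i * (area \<beta> div r)))"
        using r by (auto simp: monom_sum bounded_comps_def intro!: sum.cong)
    qed
    also have "\<dots> = (\<Sum>\<beta>\<in>?C. monom (c i \<beta>) (i * (area \<beta> div r)))"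
      by (rule sum_bounded_dvd_comps[OF r, symmetric])
    finally show ?thesis .
  qed
  have "(\<Sum>S | S \<subseteq> V. monom (\<Prod>v\<in>S. x v ^ r) (\<Sum>v\<in>S. fst v)) = (\<Prod>v\<in>V. 1 + monom (x v ^ r) (fst v))"
    using prod_add[OF V(1), of "\<lambda>v. monom (x v ^ r) (fst v)" "\<lambda>_. 1"]
    by (simp add: prod_monom add.commute Pow_def)
  also have "\<dots> = (\<Prod>i\<in>?I. \<Prod>v\<in>{v\<in>V. fst v = i}. 1 + monom (x v ^ r) (fst v))"
    by (rule prod.group[symmetric]) (use V fst_le in auto)
  also have "\<dots> = (\<Prod>i\<in>?I. \<Sum>\<beta>\<in>?C. monom (c i \<beta>) (i * (area \<beta> div r)))"
    by (simp only: block)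
  also have "\<dots> = (\<Sum>g\<in>?I \<rightarrow>\<^sub>E ?C. \<Prod>i\<in>?I. monom (c i (g i)) (i * (area (g i) div r)))"
    by (rule prod_sum_PiE) (simp_all add: finite_bounded_dvd_comps)
  also have "\<dots> = (\<Sum>g\<in>?I \<rightarrow>\<^sub>E ?C. monom (\<Prod>i\<in>?I. c i (g i)) (?wt g))"
    by (simp only: prod_monom)
  finally have "poly.coeff (\<Sum>S | S \<subseteq> V. monom (\<Prod>v\<in>S. x v ^ r) (\<Sum>v\<in>S. fst v)) d =
      poly.coeff (\<Sum>g\<in>?I \<rightarrow>\<^sub>E ?C. monom (\<Prod>i\<in>?I. c i (g i)) (?wt g)) d" by (rule arg_cong)
  moreover have "poly.coeff (\<Sum>S | S \<subseteq> V. monom (\<Prod>v\<in>S. x v ^ r) (\<Sum>v\<in>S. fst v)) d =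
      (\<Sum>S | S \<in> {S. S \<subseteq> V} \<and> (\<Sum>v\<in>S. fst v) = d. \<Prod>v\<in>S. x v ^ r)"
    unfolding coeff_sum coeff_monom by (rule sum.inter_filter[symmetric]) (simp add: V(1))
  moreover have "poly.coeff (\<Sum>g\<in>?I \<rightarrow>\<^sub>E ?C. monom (\<Prod>i\<in>?I. c i (g i)) (?wt g)) d =
      (\<Sum>g | g \<in> ?I \<rightarrow>\<^sub>E ?C \<and> ?wt g = d. \<Prod>i\<in>?I. c i (g i))"
    unfolding coeff_sum coeff_monom
    by (rule sum.inter_filter[symmetric]) (simp add: finite_PiE finite_bounded_dvd_comps)
  moreover have "(\<Sum>g | g \<in> ?I \<rightarrow>\<^sub>E ?C \<and> ?wt g = d. \<Prod>i\<in>?I. c i (g i)) =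
      (\<Sum>\<rho>\<in>bounded_otypes r d. \<Prod>i\<in>?I. c i (\<rho> i))"
  \<comment> \<open>The two index sets differ only in the default outside \<open>{1..N}\<close>:
    \<open>undefined\<close> for extensional functions, the empty list for ordered types.\<close>
  proof (rule sum.reindex_bij_witness[of _ "\<lambda>\<rho>. restrict \<rho> ?I" "\<lambda>g i. if i \<in> ?I then g i else []"])
    have iff: "\<rho> \<in> bounded_otypes r d \<longleftrightarrow> (\<forall>i. i \<notin> ?I \<longrightarrow> \<rho> i = []) \<and>
        (\<forall>i\<in>?I. \<rho> i \<in> ?C) \<and> ?wt \<rho> = d" for \<rho>
      by (rule bounded_otypes_iff[OF r]) (simp_all add: N_def K_def)
    {
      fix \<rho> assume \<rho>: "\<rho> \<in> bounded_otypes r d"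
      show "(\<lambda>i. if i \<in> ?I then restrict \<rho> ?I i else []) = \<rho>"
        using \<rho> unfolding iff by auto
      have "?wt (restrict \<rho> ?I) = ?wt \<rho>" by (rule sum.cong) simp_all
      then show "restrict \<rho> ?I \<in> {g. g \<in> ?I \<rightarrow>\<^sub>E ?C \<and> ?wt g = d}"
        using \<rho> unfolding iff by (simp add: restrict_PiE_iff)
    next
      fix g assume g: "g \<in> {g. g \<in> ?I \<rightarrow>\<^sub>E ?C \<and> ?wt g = d}"
      show "restrict (\<lambda>i. if i \<in> ?I then g i else []) ?I = g"
        using g by (auto simp: fun_eq_iff restrict_def PiE_def extensional_def)
      have "?wt (\<lambda>i. if i \<in> ?I then g i else []) = ?wt g" by (rule sum.cong) simp_all
      then show "(\<lambda>i. if i \<in> ?I then g i else []) \<in> bounded_otypes r d"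
        using g unfolding iff by (simp add: PiE_iff)
      show "(\<Prod>i\<in>?I. c i (if i \<in> ?I then g i else [])) = (\<Prod>i\<in>?I. c i (g i))"
        by (rule prod.cong) simp_all
    }
  qed
  moreover have "(\<Prod>i\<in>?I. c i (\<rho> i)) = of_int (opsgn r \<rho>) *
      (\<Prod>i\<in>osupp \<rho>. esym_comp {v\<in>V. fst v = i} x (\<rho> i))" if "\<rho> \<in> bounded_otypes r d" for \<rho>
  proof -
    have sub: "osupp \<rho> \<subseteq> ?I"
      using that bounded_otypes_iff[OF r, of d N K \<rho>] by (auto simp: N_def K_def osupp_def)
    have dvd: "r dvd area (\<rho> i)" for i using that by (simp add: bounded_otypes_def OTyp_def)
    have "(\<Prod>i\<in>osupp \<rho>. esym_comp {v\<in>V. fst v = i} x (\<rho> i)) =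
        (\<Prod>i\<in>?I. esym_comp {v\<in>V. fst v = i} x (\<rho> i))"
      by (rule prod.mono_neutral_left) (use sub in \<open>auto simp: osupp_def esym_comp_def\<close>)
    then show ?thesis
      by (simp add: opsgn_eq_prod[OF _ sub dvd] c_def prod.distrib)
  qed
  ultimately show ?thesis by simp
qed

section \<open>Reduction to finitely many variables\<close>

lemma coeff_indets: "Defs.coeff f m \<noteq> 0 \<Longrightarrow> set_mset m \<subseteq> indets"
  using Defs.coeff[of f] unfolding polysymmetric_def by blast

lemma size_le_mdeg:
  assumes "set_mset m \<subseteq> indets"
  shows "size m \<le> mdeg m"
  using assms by (induction m) (auto simp: indets_def)

text \<open>Every indeterminate has degree at least 1, so bounded degree bounds the number of
  factors of a monomial.\<close>

lemma finite_coeff_support: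
  assumes "finite V"
  shows "finite {m. set_mset m \<subseteq> V \<and> Defs.coeff f m \<noteq> 0}"
proof -
  obtain N where N: "\<And>m. Defs.coeff f m \<noteq> 0 \<Longrightarrow> mdeg m \<le> N"
    using Defs.coeff[of f] unfolding polysymmetric_def by blast
  have "{m. set_mset m \<subseteq> V \<and> Defs.coeff f m \<noteq> 0} \<subseteq> mset ` {xs. set xs \<subseteq> V \<and> length xs \<le> N}"
  proof
    fix m assume m: "m \<in> {m. set_mset m \<subseteq> V \<and> Defs.coeff f m \<noteq> 0}"
    obtain xs where xs: "mset xs = m" using ex_mset by blast
    have "size m \<le> N" using m N[of m] size_le_mdeg[OF coeff_indets[of f m]] by auto
    with xs m show "m \<in> mset ` {xs. set xs \<subseteq> V \<and> length xs \<le> N}" by (auto intro!: image_eqI[of _ _ xs])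
  qed
  then show ?thesis by (rule finite_subset) (intro finite_imageI finite_lists_length_le assms)
qed

text \<open>Sets all variables outside \<open>V\<close> to 0. For finite \<open>V\<close> the result
  is a polynomial, and \<open>poly_mapping\<close> over the additive monoid of multisets provides
  the commutative ring for \<open>esym\<close>.\<close>

definition restrict_vars :: "(nat \<times> nat) set \<Rightarrow> psym \<Rightarrow> monom \<Rightarrow>\<^sub>0 rat" where
  "restrict_vars V f = Abs_poly_mapping (\<lambda>m. if set_mset m \<subseteq> V then Defs.coeff f m else 0)"

context
  fixes V :: "(nat \<times> nat) set"
  assumes finite_V: "finite V"
begin

lemma lookup_restrict_vars:
  "poly_mapping.lookup (restrict_vars V f) m = (if set_mset m \<subseteq> V then Defs.coeff f m else 0)"
proof -
  have "{m. (if set_mset m \<subseteq> V then Defs.coeff f m else 0) \<noteq> 0} =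
      {m. set_mset m \<subseteq> V \<and> Defs.coeff f m \<noteq> 0}" by auto
  then show ?thesis
    unfolding restrict_vars_def using finite_coeff_support[OF finite_V, of f] by simp
qed

lemma restrict_vars_add: "restrict_vars V (f + g) = restrict_vars V f + restrict_vars V g"
  by (rule poly_mapping_eqI) (simp add: lookup_restrict_vars lookup_add plus_psym.rep_eq)

lemma restrict_vars_uminus: "restrict_vars V (- f) = - restrict_vars V f"
  by (rule poly_mapping_eqI) (simp add: lookup_restrict_vars uminus_psym.rep_eq)

lemma restrict_vars_0: "restrict_vars V 0 = 0"
  by (rule poly_mapping_eqI) (simp add: lookup_restrict_vars zero_psym.rep_eq)

lemma restrict_vars_1: "restrict_vars V 1 = 1"
  by (rule poly_mapping_eqI) (simp add: lookup_restrict_vars one_psym.rep_eq lookup_one when_def)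

text \<open>A product \<open>a + b\<close> of monomials involves only variables in \<open>V\<close>
  exactly when both factors do.\<close>

lemma restrict_vars_mult: "restrict_vars V (f * g) = restrict_vars V f * restrict_vars V g"
proof (rule poly_mapping_eqI)
  fix m
  let ?f = "poly_mapping.lookup (restrict_vars V f)" and ?g = "poly_mapping.lookup (restrict_vars V g)"
  have "poly_mapping.lookup (restrict_vars V f * restrict_vars V g) m = prod_fun ?f ?g m"
    by (simp add: times_poly_mapping.rep_eq)
  also have "\<dots> = Sum_any (\<lambda>(a, b). ?f a * ?g b when m = a + b)"
    by (rule prod_fun_unfold_prod) simp_all
  also have "\<dots> = (\<Sum>(a, b) | a + b = m. ?f a * ?g b when m = a + b)"
    by (rule Sum_any.expand_superset) (auto simp: finite_msplits)
  also have "\<dots> = (\<Sum>(a, b) | a + b = m. if set_mset m \<subseteq> V then Defs.coeff f a * Defs.coeff g b else 0)"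
    by (rule sum.cong) (auto simp: lookup_restrict_vars)
  also have "\<dots> = poly_mapping.lookup (restrict_vars V (f * g)) m"
    by (simp add: lookup_restrict_vars times_psym.rep_eq mconv_def)
  finally show "poly_mapping.lookup (restrict_vars V (f * g)) m = poly_mapping.lookup (restrict_vars V f * restrict_vars V g) m" ..
qed

lemma restrict_vars_of_int: "restrict_vars V (of_int k) = of_int k"
proof -
  have "restrict_vars V (of_nat n) = of_nat n" for n
    by (induction n) (simp_all add: restrict_vars_0 restrict_vars_1 restrict_vars_add)
  then show ?thesis
    by (cases k rule: int_cases2) (simp_all add: restrict_vars_uminus)
qed

lemma restrict_vars_sum: "restrict_vars V (\<Sum>a\<in>A. f a) = (\<Sum>a\<in>A. restrict_vars V (f a))"
  by (induction A rule: infinite_finite_induct) (simp_all add: restrict_vars_0 restrict_vars_add)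

lemma restrict_vars_prod: "restrict_vars V (\<Prod>a\<in>A. f a) = (\<Prod>a\<in>A. restrict_vars V (f a))"
  by (induction A rule: infinite_finite_induct) (simp_all add: restrict_vars_1 restrict_vars_mult)

lemma restrict_vars_prod_list:
  "restrict_vars V (\<Prod>a\<leftarrow>xs. f a) = (\<Prod>a\<leftarrow>xs. restrict_vars V (f a))"
  by (induction xs) (simp_all add: restrict_vars_1 restrict_vars_mult)

end

text \<open>The coefficient of \<open>m\<close> is already visible in the finitely many variables
  that occur in \<open>m\<close>.\<close>

lemma psym_eqI_restrict_vars:
  assumes "\<And>V. finite V \<Longrightarrow> V \<subseteq> indets \<Longrightarrow> restrict_vars V f = restrict_vars V g"
  shows "f = g"
proof (rule psym_eqI)
  fix m
  show "Defs.coeff f m = Defs.coeff g m"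
  proof (cases "set_mset m \<subseteq> indets")
    case True
    then have "poly_mapping.lookup (restrict_vars (set_mset m) f) m = poly_mapping.lookup (restrict_vars (set_mset m) g) m"
      using assms[of "set_mset m"] by simp
    then show ?thesis by (simp add: lookup_restrict_vars)
  next
    case False
    then show ?thesis using coeff_indets by metis
  qed
qed

section \<open>Elementary functions and \<open>Eplus\<close> in finitely many variables\<close>

abbreviation indet :: "nat \<times> nat \<Rightarrow> monom \<Rightarrow>\<^sub>0 rat" where
  "indet v \<equiv> Poly_Mapping.single {#v#} 1"

lemma prod_indet_power:
  "finite S \<Longrightarrow> (\<Prod>v\<in>S. indet v ^ r) = Poly_Mapping.single (repeat_mset r (mset_set S)) 1"
proof -
  have pow: "Poly_Mapping.single a (1::rat) ^ r = Poly_Mapping.single (repeat_mset r a) 1" for a :: monom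
    by (induction r) (simp_all add: mult_single)
  show "finite S \<Longrightarrow> (\<Prod>v\<in>S. indet v ^ r) = Poly_Mapping.single (repeat_mset r (mset_set S)) 1"
    by (induction S rule: finite_induct) (simp_all add: pow mult_single)
qed

lemma lookup_sum_single:
  assumes "finite A" "inj_on h A"
  shows "poly_mapping.lookup (\<Sum>S\<in>A. Poly_Mapping.single (h S) 1) m = of_bool (m \<in> h ` A)"
proof -
  have "poly_mapping.lookup (\<Sum>S\<in>A. Poly_Mapping.single (h S) 1) m = (\<Sum>S\<in>A. if h S = m then 1 else 0)"
    by (simp add: lookup_sum lookup_single when_def)
  also have "\<dots> = (\<Sum>a\<in>h ` A. if a = m then 1 else 0)"
    using assms(2) by (simp add: sum.reindex)
  also have "\<dots> = of_bool (m \<in> h ` A)" using assms(1) by simp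
  finally show ?thesis .
qed

text \<open>Identifies square-free monomials with finite sets of indeterminates, the index sets of
  \<open>esym\<close>.\<close>

lemma squarefree_monom_iff: "squarefree_monom m \<longleftrightarrow> mset_set (set_mset m) = m"
proof
  assume m: "squarefree_monom m"
  show "mset_set (set_mset m) = m"
  proof (rule multiset_eqI)
    fix v
    show "count (mset_set (set_mset m)) v = count m v"
    proof (cases "v \<in># m")
      case True
      moreover have "count m v \<le> 1" using m unfolding squarefree_monom_def by blast
      ultimately show ?thesis by (simp add: le_antisym Suc_le_eq)
    qed (simp add: not_in_iff)
  qed
next
  assume "mset_set (set_mset m) = m"
  then show "squarefree_monom m"
    unfolding squarefree_monom_def by (metis count_mset_set(1,3) finite_set_mset le_numeral_extra(4) zero_le_one)
qed

lemma mdeg_mset_set: "finite S \<Longrightarrow> mdeg (mset_set S) = (\<Sum>v\<in>S. fst v)"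
  by (induction S rule: finite_induct) simp_all

lemma restrict_vars_elem:
  assumes V: "finite V" "V \<subseteq> indets"
  shows "restrict_vars V (Defs.elem i k) = esym {v\<in>V. fst v = i} indet k"
proof (rule poly_mapping_eqI)
  fix m
  let ?A = "{S. S \<subseteq> {v\<in>V. fst v = i} \<and> card S = k}"
  have fin: "finite S" if "S \<in> ?A" for S using that V(1) by (auto intro: finite_subset)
  have "(\<Prod>v\<in>S. indet v) = Poly_Mapping.single (mset_set S) 1" if "S \<in> ?A" for S
    using prod_indet_power[OF fin[OF that], of 1] by simp
  then have "esym {v\<in>V. fst v = i} indet k = (\<Sum>S\<in>?A. Poly_Mapping.single (mset_set S) 1)"
    unfolding esym_def by (intro sum.cong refl)
  then have "poly_mapping.lookup (esym {v\<in>V. fst v = i} indet k) m =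
      poly_mapping.lookup (\<Sum>S\<in>?A. Poly_Mapping.single (mset_set S) 1) m"
    by (rule arg_cong)
  also have "\<dots> = of_bool (m \<in> mset_set ` ?A)"
  proof (rule lookup_sum_single)
    show "inj_on mset_set ?A" using fin finite_set_mset_mset_set by (intro inj_on_inverseI[of _ set_mset]) blast
    show "finite ?A" using V(1) by simp
  qed
  also have "m \<in> mset_set ` ?A \<longleftrightarrow> set_mset m \<subseteq> V \<and> squarefree_monom m \<and> size m = k \<and> (\<forall>v\<in>#m. fst v = i)"
  proof
    assume "m \<in> mset_set ` ?A"
    then obtain S where "S \<in> ?A" "m = mset_set S" by blast
    with fin[of S] show "set_mset m \<subseteq> V \<and> squarefree_monom m \<and> size m = k \<and> (\<forall>v\<in>#m. fst v = i)"
      by (auto simp: squarefree_monom_iff)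
  next
    assume m: "set_mset m \<subseteq> V \<and> squarefree_monom m \<and> size m = k \<and> (\<forall>v\<in>#m. fst v = i)"
    then have "mset_set (set_mset m) = m" by (simp add: squarefree_monom_iff)
    moreover have "card (set_mset m) = k" using m calculation by (metis size_mset_set)
    ultimately show "m \<in> mset_set ` ?A" using m by (intro image_eqI[of _ _ "set_mset m"]) auto
  qed
  finally show "poly_mapping.lookup (restrict_vars V (Defs.elem i k)) m = poly_mapping.lookup (esym {v\<in>V. fst v = i} indet k) m"
    using V(2) by (auto simp: lookup_restrict_vars[OF V(1)] elem.rep_eq)
qed

lemma restrict_vars_power_subst_Eplus:
  assumes r: "r \<ge> 1" and V: "finite V" "V \<subseteq> indets"
  shows "restrict_vars V (power_subst r (Eplus d)) =
    (\<Sum>S | S \<subseteq> V \<and> (\<Sum>v\<in>S. fst v) = d. \<Prod>v\<in>S. indet v ^ r)"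
proof (rule poly_mapping_eqI)
  fix m
  let ?A = "{S. S \<subseteq> V \<and> (\<Sum>v\<in>S. fst v) = d}"
  let ?h = "\<lambda>S. repeat_mset r (mset_set S)"
  let ?P = "\<lambda>m'. set_mset m' \<subseteq> V \<and> squarefree_monom m' \<and> mdeg m' = d"
  have fin: "finite S" if "S \<in> ?A" for S using that V(1) by (auto intro: finite_subset)
  \<comment> \<open>For \<open>r \<ge> 1\<close> a monomial has at most one \<open>r\<close>-th
    root, so \<open>power_subst\<close> never merges two monomials.\<close>
  have rep_eq_iff: "repeat_mset r a = repeat_mset r b \<longleftrightarrow> a = b" for a b :: monom
    using r by (auto simp: multiset_eq_iff)
  have set_rep: "set_mset (repeat_mset r m') = set_mset m'" for m' :: monom
    unfolding set_eq_iff count_greater_zero_iff[symmetric] using r by simp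
  have "(\<Sum>S\<in>?A. \<Prod>v\<in>S. indet v ^ r) = (\<Sum>S\<in>?A. Poly_Mapping.single (?h S) 1)"
    by (rule sum.cong[OF refl]) (rule prod_indet_power[OF fin])
  then have "poly_mapping.lookup (\<Sum>S\<in>?A. \<Prod>v\<in>S. indet v ^ r) m =
      poly_mapping.lookup (\<Sum>S\<in>?A. Poly_Mapping.single (?h S) 1) m"
    by (rule arg_cong)
  also have "\<dots> = of_bool (m \<in> ?h ` ?A)"
  proof (rule lookup_sum_single)
    show "inj_on ?h ?A"
    proof (rule inj_onI)
      fix S T assume ST: "S \<in> ?A" "T \<in> ?A" and "?h S = ?h T"
      then have "set_mset (mset_set S) = set_mset (mset_set T)"
        by (simp add: rep_eq_iff)
      then show "S = T" using fin ST finite_set_mset_mset_set by blast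
    qed
    show "finite ?A" using V(1) by simp
  qed
  also have "?h ` ?A = repeat_mset r ` {m'. ?P m'}"
  proof -
    have "{m'. ?P m'} = mset_set ` ?A"
    proof (intro equalityI subsetI)
      fix m' assume m': "m' \<in> {m'. ?P m'}"
      then have eq: "mset_set (set_mset m') = m'" by (simp add: squarefree_monom_iff)
      then have "(\<Sum>v\<in>set_mset m'. fst v) = d" using m' mdeg_mset_set[of "set_mset m'"] by simp
      then show "m' \<in> mset_set ` ?A" using m' eq by (intro image_eqI[of _ _ "set_mset m'"]) auto
    next
      fix m' assume "m' \<in> mset_set ` ?A"
      then obtain S where "S \<in> ?A" "m' = mset_set S" by blast
      then show "m' \<in> {m'. ?P m'}"
        using fin[of S] by (auto simp: squarefree_monom_iff mdeg_mset_set)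
    qed
    then show ?thesis by (simp add: image_image)
  qed
  also have "of_bool (m \<in> repeat_mset r ` {m'. ?P m'}) = poly_mapping.lookup (restrict_vars V (power_subst r (Eplus d))) m"
  proof (cases "\<exists>m'. repeat_mset r m' = m")
    case True
    then obtain m' where m': "repeat_mset r m' = m" by blast
    then have "{m''. repeat_mset r m'' = m} = {m'}"
      by (simp add: rep_eq_iff flip: m')
    then have "poly_mapping.lookup (restrict_vars V (power_subst r (Eplus d))) m =
        (if set_mset m \<subseteq> V then of_bool (set_mset m' \<subseteq> indets \<and> squarefree_monom m' \<and> mdeg m' = d) else 0)"
      by (simp only: lookup_restrict_vars[OF V(1)] power_subst.rep_eq Eplus.rep_eq) simp
    also have "\<dots> = of_bool (?P m')"
      using V(2) set_rep[of m'] m' by (simp add: subset_trans)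
    also have "?P m' \<longleftrightarrow> m \<in> repeat_mset r ` {m'. ?P m'}"
      unfolding m'[symmetric] image_iff rep_eq_iff by simp
    finally show ?thesis ..
  next
    case False
    then have "{m''. repeat_mset r m'' = m} = {}" "m \<notin> repeat_mset r ` {m'. ?P m'}" by auto
    then show ?thesis
      by (simp only: lookup_restrict_vars[OF V(1)] power_subst.rep_eq sum.empty) simp
  qed
  finally show "poly_mapping.lookup (restrict_vars V (power_subst r (Eplus d))) m =
      poly_mapping.lookup (\<Sum>S\<in>?A. \<Prod>v\<in>S. indet v ^ r) m" ..
qed

text \<open>In each finite set of variables this is the identity for sums over subsets, evaluated at
  the indeterminates.\<close>

lemma power_subst_Eplus_expansion:
  assumes r: "r \<ge> 1"
  shows "power_subst r (Eplus d) = (\<Sum>\<rho>\<in>bounded_otypes r d. of_int (opsgn r \<rho>) * e_tensor \<rho>)"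
proof (rule psym_eqI_restrict_vars)
  fix V :: "(nat \<times> nat) set" assume V: "finite V" "V \<subseteq> indets"
  have "restrict_vars V (power_subst r (Eplus d)) =
      (\<Sum>\<rho>\<in>bounded_otypes r d. of_int (opsgn r \<rho>) *
        (\<Prod>i\<in>osupp \<rho>. esym_comp {v\<in>V. fst v = i} indet (\<rho> i)))"
    unfolding restrict_vars_power_subst_Eplus[OF r V]
    by (rule sum_subsets_power_eq_sum_otypes[OF r V(1)]) (use V(2) in \<open>auto simp: indets_def\<close>)
  also have "\<dots> = restrict_vars V (\<Sum>\<rho>\<in>bounded_otypes r d. of_int (opsgn r \<rho>) * e_tensor \<rho>)"
    by (simp add: restrict_vars_sum[OF V(1)] restrict_vars_mult[OF V(1)] restrict_vars_of_int[OF V(1)]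
        e_tensor_def restrict_vars_prod[OF V(1)] restrict_vars_prod_list[OF V(1)]
        restrict_vars_elem[OF V] esym_comp_def)
  finally show "restrict_vars V (power_subst r (Eplus d)) =
      restrict_vars V (\<Sum>\<rho>\<in>bounded_otypes r d. of_int (opsgn r \<rho>) * e_tensor \<rho>)" .
qed

section \<open>Linear independence\<close>

text \<open>Indexing by multisets of blocks turns multiplication into addition of indices.\<close>

definition e_blocks :: "(nat \<times> nat) multiset \<Rightarrow> psym" where
  "e_blocks B = (\<Prod>(i, k)\<in>#B. Defs.elem i k)"

text \<open>
  \<open>dominance B i\<close> lists the partial sums of the conjugate of the partition formed by the \<open>k\<close>
  with \<open>(i, k)\<close> in \<open>B\<close>, so the pointwise order is the dominance order of the conjugates.
\<close>

definition dominance :: "(nat \<times> nat) multiset \<Rightarrow> nat \<Rightarrow> nat \<Rightarrow> nat" where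
  "dominance B i q = (\<Sum>(i', k)\<in>#B. if i' = i then min k q else 0)"

text \<open>The total exponent in \<open>m\<close> of the first \<open>q\<close> indeterminates of
  degree \<open>i\<close>.\<close>

definition initial_count :: "monom \<Rightarrow> nat \<Rightarrow> nat \<Rightarrow> nat" where
  "initial_count m i q = size (filter_mset (\<lambda>v. v \<in> {i} \<times> {1..q}) m)"

text \<open>Every factor \<open>elem i k\<close> contributes its monomial in the first
  \<open>k\<close> indeterminates.\<close>

definition leading_monom :: "(nat \<times> nat) multiset \<Rightarrow> monom" where
  "leading_monom B = (\<Sum>(i, k)\<in>#B. mset_set ({i} \<times> {1..k}))"

text \<open>Excluding \<open>k = 0\<close> matters for injectivity of \<open>e_blocks\<close>,
  because \<open>elem i 0 = 1\<close>.\<close>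

definition valid_blocks :: "(nat \<times> nat) multiset \<Rightarrow> bool" where
  "valid_blocks B \<longleftrightarrow> (\<forall>(i, k)\<in>#B. i \<ge> 1 \<and> k \<ge> 1)"

lemma e_blocks_simps [simp]:
  "e_blocks {#} = 1"
  "e_blocks (add_mset (i, k) B) = Defs.elem i k * e_blocks B"
  "e_blocks (A + B) = e_blocks A * e_blocks B"
  by (simp_all add: e_blocks_def)

lemma initial_count_squarefree:
  assumes "squarefree_monom a" "size a = k" "\<forall>v\<in>#a. fst v = i'"
  shows "initial_count a i q \<le> (if i' = i then min k q else 0)"
proof (cases "i' = i")
  case True
  have "mset_set (set_mset a) = a" using assms(1) by (simp add: squarefree_monom_iff)
  then have "filter_mset (\<lambda>v. v \<in> {i} \<times> {1..q}) a = mset_set (set_mset a \<inter> {i} \<times> {1..q})"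
    by (metis filter_mset_mset_set finite_set_mset Collect_conj_eq Collect_mem_eq)
  then have "initial_count a i q = card (set_mset a \<inter> {i} \<times> {1..q})"
    by (simp add: initial_count_def)
  also have "\<dots> \<le> card ({i} \<times> {1..q})" by (intro card_mono) auto
  also have "\<dots> = q" by (simp add: card_cartesian_product)
  finally have "initial_count a i q \<le> q" .
  moreover have "initial_count a i q \<le> k"
    unfolding initial_count_def assms(2)[symmetric] by (rule size_filter_mset_lesseq)
  ultimately show ?thesis using True by simp
next
  case False
  then have "filter_mset (\<lambda>v. v \<in> {i} \<times> {1..q}) a = {#}"
    using assms(3) by (intro multiset_eqI) (auto simp: count_eq_zero_iff)
  with False show ?thesis by (simp add: initial_count_def)
qed

text \<open>A monomial of the product takes a square-free monomial of \<open>k\<close> factors from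
  each \<open>elem i k\<close>, and at most \<open>min k q\<close> of these are among the first
  \<open>q\<close> indeterminates.\<close>

lemma initial_count_le_dominance:
  assumes "Defs.coeff (e_blocks B) m \<noteq> 0"
  shows "initial_count m i q \<le> dominance B i q"
  using assms
proof (induction B arbitrary: m)
  case empty
  then show ?case by (simp add: one_psym.rep_eq initial_count_def split: if_splits)
next
  case (add b B)
  obtain i' k where b: "b = (i', k)" by (cases b)
  have "mconv (Defs.coeff (Defs.elem i' k)) (Defs.coeff (e_blocks B)) m \<noteq> 0"
    using add.prems by (simp add: b times_psym.rep_eq)
  then obtain a c where ac: "m = a + c" "Defs.coeff (Defs.elem i' k) a \<noteq> 0" "Defs.coeff (e_blocks B) c \<noteq> 0"
    by (rule mconv_nonzeroE)
  have "initial_count a i q \<le> (if i' = i then min k q else 0)"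
    by (rule initial_count_squarefree) (use ac(2) in \<open>auto simp: elem.rep_eq split: if_splits\<close>)
  with add.IH[OF ac(3)] show ?case
    by (simp add: b ac(1) initial_count_def dominance_def)
qed

lemma initial_count_leading_monom:
  assumes "valid_blocks B"
  shows "initial_count (leading_monom B) i q = dominance B i q"
  using assms
proof (induction B)
  case empty
  then show ?case by (simp add: initial_count_def leading_monom_def dominance_def)
next
  case (add b B)
  obtain i' k where b: "b = (i', k)" by (cases b)
  have "initial_count (mset_set ({i'} \<times> {1..k})) i q = (if i' = i then min k q else 0)"
  proof -
    have "initial_count (mset_set ({i'} \<times> {1..k})) i q = card ({i'} \<times> {1..k} \<inter> {i} \<times> {1..q})"
      by (simp add: initial_count_def filter_mset_mset_set Collect_conj_eq)
    also have "{i'} \<times> {1..k} \<inter> {i} \<times> {1..q} = (if i' = i then {i} \<times> {1..min k q} else {})" by auto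
    finally show ?thesis by (simp add: card_cartesian_product)
  qed
  with add show ?case
    by (simp add: b initial_count_def leading_monom_def dominance_def valid_blocks_def)
qed

lemma coeff_e_blocks_nonneg: "Defs.coeff (e_blocks B) m \<ge> 0"
proof (induction B arbitrary: m)
  case empty
  then show ?case by (simp add: one_psym.rep_eq)
next
  case (add b B)
  obtain i k where b: "b = (i, k)" by (cases b)
  show ?case unfolding b e_blocks_simps times_psym.rep_eq mconv_def
    by (rule sum_nonneg) (auto simp: elem.rep_eq intro!: add.IH mult_nonneg_nonneg)
qed

lemma coeff_e_blocks_leading_monom:
  assumes "valid_blocks B"
  shows "Defs.coeff (e_blocks B) (leading_monom B) > 0"
  using assms
proof (induction B)
  case empty
  then show ?case by (simp add: one_psym.rep_eq leading_monom_def)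
next
  case (add b B)
  obtain i k where b: "b = (i, k)" by (cases b)
  let ?a = "mset_set ({i} \<times> {1..k})" and ?c = "leading_monom B"
  let ?f = "\<lambda>(a, c). Defs.coeff (Defs.elem i k) a * Defs.coeff (e_blocks B) c"
  have i: "i \<ge> 1" and B: "valid_blocks B" using add.prems by (auto simp: b valid_blocks_def)
  have "Defs.coeff (Defs.elem i k) ?a = 1"
    using i by (auto simp: elem.rep_eq squarefree_monom_iff indets_def card_cartesian_product)
  then have "0 < ?f (?a, ?c)" using add.IH[OF B] by simp
  \<comment> \<open>The split into the two leading monomials is one term of the convolution, and no
    term is negative, so nothing cancels it.\<close>
  also have "\<dots> \<le> sum ?f {(a, c). a + c = ?a + ?c}"
  proof (rule member_le_sum)
    show "0 \<le> ?f x" for x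
      by (auto simp: case_prod_unfold elem.rep_eq coeff_e_blocks_nonneg)
  qed (auto simp: finite_msplits)
  also have "\<dots> = Defs.coeff (e_blocks (add_mset b B)) (leading_monom (add_mset b B))"
    by (simp add: b leading_monom_def times_psym.rep_eq mconv_def)
  finally show ?case .
qed

text \<open>The second difference in \<open>q\<close> of \<open>min k q\<close> is the indicator of \<open>q = k\<close>.\<close>

lemma count_add_dominance:
  assumes "k \<ge> 1"
  shows "count B (i, k) + dominance B i (k - 1) + dominance B i (k + 1) = 2 * dominance B i k"
proof (induction B)
  case empty
  then show ?case by (simp add: dominance_def)
next
  case (add b B)
  obtain i' k' where b: "b = (i', k')" by (cases b)
  have D: "dominance (add_mset b B) i q = (if i' = i then min k' q else 0) + dominance B i q" for q
    by (simp add: b dominance_def)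
  have diff: "(if b = (i, k) then 1 else 0) + (if i' = i then min k' (k - 1) else 0) +
      (if i' = i then min k' (k + 1) else 0) = 2 * (if i' = i then min k' k else 0)"
    using assms by (auto simp: b)
  have C: "count (add_mset b B) (i, k) = (if b = (i, k) then 1 else 0) + count B (i, k)"
    by simp
  have "p + c + (x + u) + (y + v) = 2 * (z + w)"
    if "p + x + y = 2 * z" "c + u + v = 2 * w" for p c x u y v z w :: nat
    using that by presburger
  then show ?case unfolding C D using diff add.IH .
qed

text \<open>Second differences of \<open>dominance\<close> recover the multiplicities for
  \<open>k \<ge> 1\<close>; validity settles \<open>k = 0\<close>.\<close>

lemma dominance_inject:
  assumes "valid_blocks B" "valid_blocks C" "dominance B = dominance C"
  shows "B = C"
proof (rule multiset_eqI)
  fix b :: "nat \<times> nat"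
  obtain i k where b: "b = (i, k)" by (cases b)
  show "count B b = count C b"
  proof (cases "k \<ge> 1")
    case True
    then show ?thesis
      using count_add_dominance[OF True, of B i] count_add_dominance[OF True, of C i] assms(3)
      by (simp add: b)
  next
    case False
    then have "b \<notin># B" "b \<notin># C" using assms(1,2) by (auto simp: b valid_blocks_def)
    then show ?thesis by (simp add: not_in_iff)
  qed
qed

section \<open>Triangularity with respect to dominance\<close>

lemma coeff_leading_monom_imp_dominance_le:
  assumes "valid_blocks C" "Defs.coeff (e_blocks B) (leading_monom C) \<noteq> 0"
  shows "dominance C \<le> dominance B"
  using initial_count_le_dominance[OF assms(2)] initial_count_leading_monom[OF assms(1)]
  by (simp add: le_fun_def)

text \<open>If the functions agree, each contains the leading monomial of the other, so the two
  dominance functions bound each other.\<close>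

lemma inj_on_e_blocks: "inj_on e_blocks {B. valid_blocks B}"
proof (rule inj_onI)
  fix B C assume BC: "B \<in> {B. valid_blocks B}" "C \<in> {B. valid_blocks B}" and eq: "e_blocks B = e_blocks C"
  have "Defs.coeff (e_blocks B) (leading_monom C) \<noteq> 0" "Defs.coeff (e_blocks C) (leading_monom B) \<noteq> 0"
    using BC eq coeff_e_blocks_leading_monom[of B] coeff_e_blocks_leading_monom[of C] by auto
  then have "dominance C = dominance B"
    using BC by (intro antisym coeff_leading_monom_imp_dominance_le) auto
  then show "B = C" using BC dominance_inject by auto
qed

lemma psym_coeff_sum: "Defs.coeff (\<Sum>a\<in>A. f a) m = (\<Sum>a\<in>A. Defs.coeff (f a) m)"
  by (induction A rule: infinite_finite_induct) (simp_all add: zero_psym.rep_eq plus_psym.rep_eq)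

text \<open>In a linear relation, the leading monomial of a dominance-maximal index with nonzero
  coefficient occurs in no other summand with nonzero coefficient.\<close>

lemma independent_e_blocks: "psym.independent (e_blocks ` {B. valid_blocks B})"
proof
  assume "psym.dependent (e_blocks ` {B. valid_blocks B})"
  then obtain t u where t: "finite t" "t \<subseteq> e_blocks ` {B. valid_blocks B}"
      "(\<Sum>v\<in>t. scale_psym (u v) v) = 0" "\<exists>v\<in>t. u v \<noteq> 0"
    unfolding psym.dependent_explicit by blast
  define T where "T = {B. valid_blocks B \<and> e_blocks B \<in> t \<and> u (e_blocks B) \<noteq> 0}"
  have "finite T"
  proof (rule finite_imageD)
    show "finite (e_blocks ` T)" by (rule finite_subset[OF _ t(1)]) (auto simp: T_def)
    show "inj_on e_blocks T" by (rule inj_on_subset[OF inj_on_e_blocks]) (auto simp: T_def)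
  qed
  moreover have "T \<noteq> {}" using t(2,4) by (auto simp: T_def)
  ultimately obtain C where C: "C \<in> T" and max: "\<And>B. B \<in> T \<Longrightarrow> dominance C \<le> dominance B \<Longrightarrow> dominance C = dominance B"
    using finite_has_maximal[of "dominance ` T"] by auto
  have vC: "valid_blocks C" using C by (simp add: T_def)
  let ?m = "leading_monom C"
  have "0 = Defs.coeff (\<Sum>v\<in>t. scale_psym (u v) v) ?m"
    by (simp add: t(3) zero_psym.rep_eq)
  also have "\<dots> = (\<Sum>v\<in>t. u v * Defs.coeff v ?m)" by (simp add: psym_coeff_sum scale_psym.rep_eq)
  also have "\<dots> = (\<Sum>v\<in>{e_blocks C}. u v * Defs.coeff v ?m)"
  proof (rule sum.mono_neutral_right)
    show "{e_blocks C} \<subseteq> t" using C by (simp add: T_def)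
    show "\<forall>v\<in>t - {e_blocks C}. u v * Defs.coeff v ?m = 0"
    proof (rule ballI, rule ccontr)
      fix v assume v: "v \<in> t - {e_blocks C}" "u v * Defs.coeff v ?m \<noteq> 0"
      then obtain B where B: "v = e_blocks B" "valid_blocks B" using t(2) by auto
      have "B \<in> T" using v B by (simp add: T_def)
      moreover have "dominance C \<le> dominance B"
        using v(2) B(1) by (intro coeff_leading_monom_imp_dominance_le[OF vC]) simp
      ultimately have "dominance C = dominance B" by (rule max)
      then have "B = C" using dominance_inject[OF B(2) vC] by simp
      with v(1) B(1) show False by simp
    qed
  qed (rule t(1))
  also have "\<dots> \<noteq> 0" using C coeff_e_blocks_leading_monom[OF vC] by (simp add: T_def)
  finally show False by simp
qed

section \<open>Expansion over tabloids\<close>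

lemma e_blocks_sum: "finite A \<Longrightarrow> e_blocks (\<Sum>a\<in>A. f a) = (\<Prod>a\<in>A. e_blocks (f a))"
  by (induction A rule: finite_induct) simp_all

lemma e_blocks_sum_list: "e_blocks (\<Sum>a\<leftarrow>xs. f a) = (\<Prod>a\<leftarrow>xs. e_blocks (f a))"
  by (induction xs) simp_all

lemma e_tensor_eq_e_blocks:
  assumes "finite (osupp \<delta>)"
  shows "e_tensor \<delta> = e_blocks (blocks \<delta>)"
proof -
  have "e_blocks {#(d, r). r \<in># mset xs#} = (\<Prod>k\<leftarrow>xs. Defs.elem d k)" for d xs
    by (induction xs) simp_all
  then show ?thesis
    by (simp add: e_tensor_def blocks_def e_blocks_sum[OF assms] del: mset_map)
qed

section \<open>Types and their multisets of blocks\<close>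

lemma blocks_psort: "blocks (psort \<delta>) = blocks \<delta>"
proof -
  have "psort \<delta> i = [] \<longleftrightarrow> \<delta> i = []" for i
    by (metis length_0_conv length_rev length_sort psort_def)
  then have "osupp (psort \<delta>) = osupp \<delta>" by (simp add: osupp_def)
  then show ?thesis by (simp add: blocks_def psort_def)
qed

lemma count_blocks:
  assumes "finite (osupp \<delta>)"
  shows "count (blocks \<delta>) (d, r) = count (mset (\<delta> d)) r"
proof -
  have "count {#(d', r). r \<in># M#} (d, r) = (if d' = d then count M r else 0)" for d' M
    by (induction M) auto
  then have "count (blocks \<delta>) (d, r) = (\<Sum>d'\<in>osupp \<delta>. if d' = d then count (mset (\<delta> d')) r else 0)"
    by (simp add: blocks_def count_sum)
  then show ?thesis using assms by (auto simp: osupp_def)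
qed

text \<open>The degree of \<open>e_blocks B\<close>, since \<open>elem d r\<close> is homogeneous of
  degree \<open>d * r\<close>.\<close>

definition weight :: "(nat \<times> nat) multiset \<Rightarrow> nat" where
  "weight B = (\<Sum>(d, r)\<in>#B. d * r)"

lemma weight_simps [simp]: "weight {#} = 0" "weight (A + B) = weight A + weight B"
  by (simp_all add: weight_def)

lemma weight_sum: "finite A \<Longrightarrow> weight (\<Sum>a\<in>A. f a) = (\<Sum>a\<in>A. weight (f a))"
  by (induction A rule: finite_induct) simp_all

lemma weight_sum_list: "weight (\<Sum>a\<leftarrow>xs. f a) = (\<Sum>a\<leftarrow>xs. weight (f a))"
  by (induction xs) simp_all

lemma valid_blocks_sum_list:
  "(\<And>a. a \<in> set xs \<Longrightarrow> valid_blocks (f a)) \<Longrightarrow> valid_blocks (\<Sum>a\<leftarrow>xs. f a)"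
  by (induction xs) (auto simp: valid_blocks_def)

lemma weight_blocks:
  assumes "finite (osupp \<delta>)"
  shows "weight (blocks \<delta>) = (\<Sum>i\<in>osupp \<delta>. i * area (\<delta> i))"
proof -
  have "weight {#(d, r). r \<in># mset xs#} = d * sum_list xs" for d xs
    by (induction xs) (simp_all add: weight_def distrib_left)
  then show ?thesis by (simp add: blocks_def weight_sum[OF assms] del: mset_map)
qed

lemma ordered_type_blocks:
  assumes "ordered_type n \<delta>"
  shows "valid_blocks (blocks \<delta>)" "weight (blocks \<delta>) = n"
proof -
  have fin: "finite (osupp \<delta>)" and 0: "\<delta> 0 = []" and comp: "\<And>i. composition (\<delta> i)"
    and sum: "(\<Sum>i\<in>osupp \<delta>. i * area (\<delta> i)) = n"
    using assms by (auto simp: ordered_type_def)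
  show "valid_blocks (blocks \<delta>)" unfolding valid_blocks_def
  proof clarify
    fix d r assume "(d, r) \<in># blocks \<delta>"
    then have "r \<in> set (\<delta> d)"
      using count_blocks[OF fin, of d r] by (metis count_greater_zero_iff set_mset_mset)
    moreover from this have "d \<noteq> 0" using 0 by (metis empty_iff list.set(1))
    ultimately show "d \<ge> 1 \<and> r \<ge> 1" using comp[of d] by (auto simp: composition_def Suc_le_eq intro: gr0I)
  qed
  show "weight (blocks \<delta>) = n" using weight_blocks[OF fin] sum by simp
qed

text \<open>Listing the parts for each \<open>d\<close> in decreasing order gives the type. Hence
  every \<open>e_blocks B\<close> with valid \<open>B\<close> is one of the \<open>e_tensor\<close>
  basis elements.\<close>

lemma ex_type_of_blocks:
  assumes "valid_blocks B"
  obtains \<tau> where "is_type (weight B) \<tau>" "blocks \<tau> = B"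
proof -
  define \<tau> :: otype where
    "\<tau> d = rev (sorted_list_of_multiset (image_mset snd (filter_mset (\<lambda>b. fst b = d) B)))" for d
  have mset: "mset (\<tau> d) = image_mset snd (filter_mset (\<lambda>b. fst b = d) B)" for d
    by (simp add: \<tau>_def)
  have mem: "r \<in> set (\<tau> d) \<longleftrightarrow> (d, r) \<in># B" for d r
  proof -
    have set: "set (\<tau> d) = snd ` {b \<in> set_mset B. fst b = d}"
      unfolding set_mset_mset[symmetric] mset by simp
    show ?thesis
    proof
      assume "(d, r) \<in># B"
      then have "snd (d, r) \<in> snd ` {b \<in> set_mset B. fst b = d}" by (intro imageI) simp
      then show "r \<in> set (\<tau> d)" by (simp add: set)
    qed (auto simp: set)
  qed
  have "osupp \<tau> \<subseteq> fst ` set_mset B"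
  proof
    fix d assume "d \<in> osupp \<tau>"
    then have "hd (\<tau> d) \<in> set (\<tau> d)" by (simp add: osupp_def)
    then have "fst (d, hd (\<tau> d)) \<in> fst ` set_mset B" unfolding mem by (rule imageI)
    then show "d \<in> fst ` set_mset B" by simp
  qed
  then have fin: "finite (osupp \<tau>)" by (rule finite_subset) simp
  have "blocks \<tau> = B"
  proof (rule multiset_eqI)
    fix b :: "nat \<times> nat"
    obtain d r where b: "b = (d, r)" by (cases b)
    have "count (image_mset snd (filter_mset (\<lambda>b. fst b = d) B)) r = count B (d, r)"
      by (induction B) auto
    then show "count (blocks \<tau>) b = count B b" by (simp add: b count_blocks[OF fin] mset)
  qed
  moreover have "is_type (weight B) \<tau>"
    unfolding is_type_def ordered_type_def
  proof (intro conjI allI)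
    have "r \<notin> set (\<tau> 0)" for r using assms by (auto simp: mem valid_blocks_def)
    then show "\<tau> 0 = []" by (cases "\<tau> 0") auto
    show "composition (\<tau> i)" for i
      using assms by (auto simp: composition_def mem valid_blocks_def)
    show "sorted_wrt (\<ge>) (\<tau> i)" for i by (simp add: \<tau>_def sorted_wrt_rev)
    show "(\<Sum>i\<in>osupp \<tau>. i * area (\<tau> i)) = weight B"
      using weight_blocks[OF fin] \<open>blocks \<tau> = B\<close> by simp
  qed (rule fin)
  ultimately show thesis using that by blast
qed

text \<open>Distributivity with the choices recorded as lists, the shape of tabloids. The
  coefficients depend on the position through \<open>bs ! i\<close>, the factors \<open>g\<close>
  only on the choice.\<close>

lemma prod_list_sum_eq_sum_lists:
  fixes c :: "'b \<Rightarrow> 'd \<Rightarrow> 'a::comm_ring_1"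
  assumes "\<And>b. b \<in> set bs \<Longrightarrow> finite (P b)"
  shows "(\<Prod>b\<leftarrow>bs. \<Sum>D\<in>P b. c b D * g D) =
    (\<Sum>T | length T = length bs \<and> (\<forall>i<length bs. T ! i \<in> P (bs ! i)).
      (\<Prod>i<length bs. c (bs ! i) (T ! i)) * (\<Prod>D\<leftarrow>T. g D))"
  using assms
proof (induction bs)
  case Nil
  then show ?case by simp
next
  case (Cons b bs)
  let ?L = "\<lambda>bs. {T. length T = length bs \<and> (\<forall>i<length bs. T ! i \<in> P (bs ! i))}"
  let ?t = "\<lambda>bs T. (\<Prod>i<length bs. c (bs ! i) (T ! i)) * (\<Prod>D\<leftarrow>T. g D)"
  have "?L (b # bs) = (\<lambda>(D, T). D # T) ` (P b \<times> ?L bs)"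
    by (auto simp: length_Suc_conv image_iff nth_Cons split: nat.splits)
  then have "(\<Sum>T\<in>?L (b # bs). ?t (b # bs) T) = (\<Sum>(D, T)\<in>P b \<times> ?L bs. ?t (b # bs) (D # T))"
    by (simp add: sum.reindex inj_on_def case_prod_unfold)
  also have "\<dots> = (\<Sum>(D, T)\<in>P b \<times> ?L bs. (c b D * g D) * ?t bs T)"
    by (rule sum.cong) (auto simp del: prod.lessThan_Suc simp: prod.lessThan_Suc_shift mult_ac)
  also have "\<dots> = (\<Sum>D\<in>P b. c b D * g D) * (\<Sum>T\<in>?L bs. ?t bs T)"
    by (simp only: sum_product sum.cartesian_product)
  finally show ?case using Cons by simp
qed

lemma finite_lists_nth_mem:
  assumes "\<And>b. b \<in> set bs \<Longrightarrow> finite (P b)"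
  shows "finite {T. length T = length bs \<and> (\<forall>i<length bs. T ! i \<in> P (bs ! i))}"
proof (rule finite_subset)
  show "{T. length T = length bs \<and> (\<forall>i<length bs. T ! i \<in> P (bs ! i))} \<subseteq>
      {T. set T \<subseteq> (\<Union>b\<in>set bs. P b) \<and> length T = length bs}"
    by (fastforce simp: in_set_conv_nth)
  show "finite {T. set T \<subseteq> (\<Union>b\<in>set bs. P b) \<and> length T = length bs}"
    using assms by (intro finite_lists_length_eq) blast
qed

text \<open>Connects the ring products in the expansions with the scaling in
  \<open>psym.representation\<close>.\<close>

lemma of_int_mult_psym: "of_int k * f = scale_psym (of_int k) f"
proof -
  have nat: "of_nat j * f = scale_psym (of_nat j) f" for j
    by (induction j) (simp_all add: distrib_right psym.scale_left_distrib)
  show ?thesis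
    by (cases k rule: int_cases2) (simp_all add: nat psym.scale_minus_left)
qed

section \<open>Polywrappings indexed by their ordered contents\<close>

definition bounded_polywrappings :: "nat \<times> nat \<Rightarrow> polywrapping set" where
  "bounded_polywrappings b = {D \<in> polywrappings b. bounded_polywrapping (snd b) D}"

text \<open>Boundedness concerns heights \<open>k \<ge> 1\<close>, while
  \<open>bounded_otypes\<close> bounds every component; both agree because \<open>\<rho> 0\<close>
  is empty.\<close>

lemma bounded_polywrappings_eq:
  "bounded_polywrappings (d, r) = polywrap r ` bounded_otypes r d"
proof -
  have "bounded_polywrapping r (polywrap r \<rho>) \<longleftrightarrow> (\<forall>k. length (\<rho> k) \<le> r)" if "\<rho> \<in> OTyp r (d * r)" for \<rho>
  proof -
    have "length (\<rho> 0) \<le> r" using that by (simp add: OTyp_def ordered_type_def)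
    then have "(\<forall>k\<ge>1. length (\<rho> k) \<le> r) \<longleftrightarrow> (\<forall>k. length (\<rho> k) \<le> r)"
      by (metis One_nat_def Suc_leI gr0I)
    then show ?thesis by (simp add: bounded_polywrapping_def polywrap_def wrapping_def)
  qed
  then show ?thesis by (auto simp: bounded_polywrappings_def polywrappings_def bounded_otypes_def)
qed

lemma pocon_polywrap_bounded: "r \<ge> 1 \<Longrightarrow> \<rho> \<in> bounded_otypes r d \<Longrightarrow> pocon (polywrap r \<rho>) = \<rho>"
  by (rule pocon_polywrap[of r \<rho> "d * r"]) (simp_all add: bounded_otypes_def)

lemma pocon_bounded_polywrappings:
  assumes "snd b \<ge> 1" "D \<in> bounded_polywrappings b"
  shows "ordered_type (fst b * snd b) (pocon D)"
  using assms bounded_polywrappings_eq[of "fst b" "snd b"] pocon_polywrap_bounded[of "snd b" _ "fst b"]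
  by (auto simp: bounded_otypes_def OTyp_def)

lemma finite_bounded_polywrappings: "snd b \<ge> 1 \<Longrightarrow> finite (bounded_polywrappings b)"
  using bounded_polywrappings_eq[of "fst b" "snd b"] by (simp add: finite_bounded_otypes)

text \<open>A polywrapping is determined by its ordered content, which \<open>pocon\<close>
  recovers, so the sum over ordered types can be reindexed.\<close>

lemma power_subst_Eplus_polywrappings:
  assumes "snd b \<ge> 1"
  shows "power_subst (snd b) (Eplus (fst b)) =
    (\<Sum>D\<in>bounded_polywrappings b. of_int (psgn (snd b) D) * e_blocks (blocks (psort (pocon D))))"
proof -
  obtain d r where b: "b = (d, r)" by (cases b)
  have r: "r \<ge> 1" using assms b by simp
  have inj: "inj_on (polywrap r) (bounded_otypes r d)"
    by (rule inj_on_inverseI[of _ pocon]) (rule pocon_polywrap_bounded[OF r])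
  have "(\<Sum>D\<in>bounded_polywrappings b. of_int (psgn (snd b) D) * e_blocks (blocks (psort (pocon D)))) =
      (\<Sum>\<rho>\<in>bounded_otypes r d. of_int (opsgn r \<rho>) * e_tensor \<rho>)"
    unfolding b bounded_polywrappings_eq sum.reindex[OF inj]
  proof (rule sum.cong[OF refl])
    fix \<rho> assume \<rho>: "\<rho> \<in> bounded_otypes r d"
    then have "finite (osupp \<rho>)" by (simp add: bounded_otypes_def OTyp_def ordered_type_def)
    then show "((\<lambda>D. of_int (psgn (snd (d, r)) D) * e_blocks (blocks (psort (pocon D)))) \<circ> polywrap r) \<rho> =
        of_int (opsgn r \<rho>) * e_tensor \<rho>"
      by (simp add: psgn_def opsgn_def pocon_polywrap_bounded[OF r \<rho>] blocks_psort e_tensor_eq_e_blocks)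
  qed
  then show ?thesis using power_subst_Eplus_expansion[OF r, of d] b by simp
qed

theorem theorem75:
  fixes n :: nat and \<sigma> \<tau> :: otype and bs :: "(nat \<times> nat) list"
  assumes "n > 0"
    and "is_type n \<sigma>" and "is_type n \<tau>"
    and "mset bs = blocks \<sigma>"
  shows "e_coeff n (E_type \<sigma>) \<tau> = of_int (\<Sum>T\<in>tabloids bs \<tau>. psgn_tabloid bs T)"
proof -
  let ?basis = "e_tensor ` {\<tau>. is_type n \<tau>}"
  \<comment> \<open>Lists of bounded polywrappings of arbitrary content; the tabloids are those with
    \<open>con T = blocks \<tau>\<close>.\<close>
  let ?L = "{T. length T = length bs \<and> (\<forall>i<length bs. T ! i \<in> bounded_polywrappings (bs ! i))}"
  define con where "con T = (\<Sum>D\<leftarrow>T. blocks (psort (pocon D)))" for T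
  have "ordered_type n \<sigma>" using assms(2) by (simp add: is_type_def)
  note \<sigma> = ordered_type_blocks[OF this]
  have bs: "snd b \<ge> 1" if "b \<in> set bs" for b
    using that \<sigma>(1) assms(4) by (metis (mono_tags, lifting) case_prodD prod.collapse set_mset_mset valid_blocks_def)
  have finL: "finite ?L" by (rule finite_lists_nth_mem) (rule finite_bounded_polywrappings[OF bs])

  have "E_type \<sigma> = (\<Prod>b\<leftarrow>bs. power_subst (snd b) (Eplus (fst b)))"
    by (simp add: E_type_def assms(4)[symmetric] case_prod_unfold flip: mset_map prod_mset_prod_list)
  also have "\<dots> = (\<Prod>b\<leftarrow>bs. \<Sum>D\<in>bounded_polywrappings b.
      of_int (psgn (snd b) D) * e_blocks (blocks (psort (pocon D))))"
    by (intro arg_cong[where f = prod_list] map_cong refl power_subst_Eplus_polywrappings bs)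
  also have "\<dots> = (\<Sum>T\<in>?L. (\<Prod>i<length bs. of_int (psgn (snd (bs ! i)) (T ! i))) *
      (\<Prod>D\<leftarrow>T. e_blocks (blocks (psort (pocon D)))))"
    by (rule prod_list_sum_eq_sum_lists) (rule finite_bounded_polywrappings[OF bs])
  also have "\<dots> = (\<Sum>T\<in>?L. scale_psym (of_int (psgn_tabloid bs T)) (e_blocks (con T)))"
    unfolding of_int_mult_psym[symmetric] by (simp add: psgn_tabloid_def con_def e_blocks_sum_list)
  finally have expansion: "E_type \<sigma> = (\<Sum>T\<in>?L. scale_psym (of_int (psgn_tabloid bs T)) (e_blocks (con T)))" .

  \<comment> \<open>Each polywrapping preserves the weight of its block, so the contents in the
    expansion all belong to types of \<open>n\<close>.\<close>
  have con: "valid_blocks (con T) \<and> weight (con T) = n" if T: "T \<in> ?L" for T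
  proof
    have ot: "ordered_type (fst (bs ! i) * snd (bs ! i)) (pocon (T ! i))" if "i < length bs" for i
      using T that by (intro pocon_bounded_polywrappings bs) auto
    have "valid_blocks (blocks (pocon D))" if "D \<in> set T" for D
      using that T ordered_type_blocks(1)[OF ot] by (auto simp: in_set_conv_nth)
    then show "valid_blocks (con T)"
      unfolding con_def blocks_psort by (rule valid_blocks_sum_list)
    have "weight (con T) = (\<Sum>i<length bs. weight (blocks (pocon (T ! i))))"
      unfolding con_def weight_sum_list blocks_psort
      unfolding sum_list_sum_nth using T by (simp add: atLeast0LessThan)
    also have "\<dots> = (\<Sum>i<length bs. fst (bs ! i) * snd (bs ! i))"
      using ordered_type_blocks(2)[OF ot] by simp
    also have "\<dots> = (\<Sum>(d, r)\<leftarrow>bs. d * r)"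
      by (simp add: sum_list_sum_nth atLeast0LessThan case_prod_unfold)
    also have "\<dots> = weight (mset bs)"
      by (simp add: weight_def flip: mset_map sum_mset_sum_list)
    finally show "weight (con T) = n" using \<sigma>(2) assms(4) by simp
  qed

  have e_type: "e_tensor \<tau>' = e_blocks (blocks \<tau>')" "valid_blocks (blocks \<tau>')" if "is_type n \<tau>'" for \<tau>'
    using that ordered_type_blocks(1) by (auto simp: is_type_def ordered_type_def intro!: e_tensor_eq_e_blocks)
  have basis: "e_blocks (con T) \<in> ?basis" if "T \<in> ?L" for T
    using ex_type_of_blocks[of "con T"] con[OF that] e_type(1) by (metis image_eqI mem_Collect_eq)
  have indep: "psym.independent ?basis"
    by (rule psym.independent_mono[OF independent_e_blocks]) (use e_type in auto)
  have eq_iff: "e_tensor \<tau> = e_blocks (con T) \<longleftrightarrow> con T = blocks \<tau>" if "T \<in> ?L" for T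
    using inj_on_eq_iff[OF inj_on_e_blocks, of "blocks \<tau>" "con T"] con[OF that] e_type[OF assms(3)] by auto

  have "e_coeff n (E_type \<sigma>) \<tau> =
      (\<Sum>T\<in>?L. psym.representation ?basis (scale_psym (of_int (psgn_tabloid bs T)) (e_blocks (con T))) (e_tensor \<tau>))"
    unfolding e_coeff_def expansion
    by (subst psym.representation_sum[OF indep])
      (rule psym.span_scale, rule psym.span_base, erule basis, rule refl)
  \<comment> \<open>Each \<open>e_blocks (con T)\<close> is itself a basis element, so it
    contributes to the coefficient only when it equals \<open>e_tensor \<tau>\<close>.\<close>
  also have "\<dots> = (\<Sum>T\<in>?L. if con T = blocks \<tau> then of_int (psgn_tabloid bs T) else 0)"
    by (rule sum.cong[OF refl])
      (simp add: psym.representation_scale[OF indep psym.span_base] psym.representation_basis[OF indep]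
        basis eq_iff del: mem_Collect_eq)
  also have "\<dots> = (\<Sum>T | T \<in> ?L \<and> con T = blocks \<tau>. of_int (psgn_tabloid bs T))"
    by (rule sum.inter_filter[OF finL, symmetric])
  also have "{T. T \<in> ?L \<and> con T = blocks \<tau>} = tabloids bs \<tau>"
    by (auto simp: tabloids_def con_def bounded_polywrappings_def)
  finally show ?thesis by simp
qed

end
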